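(* Let $(X,\sigma,\varphi)$ be a $k$-Ruelle dynamical system that admits a unique solution for the positive eigenvalue problem of the dual of the Ruelle operator, and let $\mu$ be a Borel probability measure on $X$. The following are equivalent: (1) $\mu$ is quasi-invariant for $\mathcal{G}(X,\sigma)$ and the Radon–Nikodym derivative $\frac{d r^*\mu}{d s^*\mu}$ is (a.e. equal to) the continuous function $e^{c_{X,\sigma,\varphi}}$ on $\mathcal{G}(X,\sigma)$; (2) $\mathcal{L}^*_{\sigma_i,\varphi_i}\mu=\mu$ for each $i\in\{1,\dots,k\}$.
   Context: A $k$-Ruelle dynamical system is a triple $(X,\sigma,\varphi)$ with $X$ a compact metric space, $\sigma=(\sigma_1,\dots,\sigma_k)$ pairwise commuting surjective local homeomorphisms of $X$, and $\varphi=(\varphi_1,\dots,\varphi_k)\in C(X,\mathbb{R})^k$ with $\varphi_i+\varphi_j\circ\sigma_i=\varphi_j+\varphi_i\circ\sigma_j$ for all $i,j$. Ruelle operator: $(\mathcal{L}_{T,\psi}f)(x)=\sum_{y\in T^{-1}(x)}e^{\psi(y)}f(y)$, with dual $\int f\,d(\mathcal{L}^*\nu)=\int\mathcal{L}f\,d\nu$ on finite signed Borel measures. "Admits a unique solution for the positive eigenvalue problem of the dual of the Ruelle operator" means: there is a unique pair $(\boldsymbol\lambda,\nu)$ with $\boldsymbol\lambda\in(0,\infty)^k$, $\nu$ a Borel probability measure, and $\mathcal{L}^*_{\sigma_i,\varphi_i}\nu=\lambda_i\nu$ for all $i$. With $\sigma^n=\sigma_1^{n_1}\circ\cdots\circ\sigma_k^{n_k}$,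 $\mathcal{G}(X,\sigma)=\{(x,p-q,y): p,q\in\mathbb{N}^k,\ \sigma^p(x)=\sigma^q(y)\}$ is the étale groupoid with $(x,m,y)(y,n,z)=(x,m+n,z)$, $r(x,n,y)=x$, $s(x,n,y)=y$, and basic open sets $U\times\{p-q\}\times V$ ($\sigma^p(U)=\sigma^q(V)$). $c_{X,\sigma,\varphi}:\mathcal{G}(X,\sigma)\to\mathbb{R}$ is the unique continuous groupoid homomorphism with $c_{X,\sigma,\varphi}(x,\mathbf{e}_i,\sigma_i(x))=\varphi_i(x)$. For a Borel probability measure $\mu$ on $X$, define measures on $\mathcal{G}(X,\sigma)$ by $(s^*\mu)(B)=\int_X\sum_{\gamma\in\mathcal{G}_x}1_B(\gamma)\,d\mu(x)$ and $(r^*\mu)(B)=\int_X\sum_{\gamma\in\mathcal{G}^x}1_B(\gamma)\,d\mu(x)$, where $\mathcal{G}_x$ (resp. $\mathcal{G}^x$) is the set of arrows with source (resp. range) $x$; $\mu$ is quasi-invariant if $r^*\mu$ and $s^*\mu$ are mutually absolutely continuous. *)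

theory Defs
  imports "HOL-Probability.Probability"
begin

definition local_homeo :: "('a::topological_space \<Rightarrow> 'a) \<Rightarrow> bool" where
  "local_homeo T \<longleftrightarrow> continuous_on UNIV T \<and>
     (\<forall>x. \<exists>U. open U \<and> x \<in> U \<and> inj_on T U \<and> open (T ` U) \<and>
              continuous_on (T ` U) (inv_into U T))"

definition ruelle_system ::
  "nat \<Rightarrow> (nat \<Rightarrow> 'a::metric_space \<Rightarrow> 'a) \<Rightarrow> (nat \<Rightarrow> 'a \<Rightarrow> real) \<Rightarrow> bool" where
  "ruelle_system k \<sigma> \<phi> \<longleftrightarrow> compact (UNIV :: 'a set) \<and>
     (\<forall>i<k. surj (\<sigma> i) \<and> local_homeo (\<sigma> i) \<and> continuous_on UNIV (\<phi> i)) \<and>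
     (\<forall>i<k. \<forall>j<k. \<sigma> i \<circ> \<sigma> j = \<sigma> j \<circ> \<sigma> i) \<and>
     (\<forall>i<k. \<forall>j<k. \<forall>x. \<phi> i x + \<phi> j (\<sigma> i x) = \<phi> j x + \<phi> i (\<sigma> j x))"

definition ruelle_op :: "('a \<Rightarrow> 'a) \<Rightarrow> ('a \<Rightarrow> real) \<Rightarrow> ('a \<Rightarrow> real) \<Rightarrow> 'a \<Rightarrow> real" where
  "ruelle_op T \<psi> f x = (\<Sum>y\<in>{y. T y = x}. exp (\<psi> y) * f y)"

definition borel_prob :: "'a::topological_space measure \<Rightarrow> bool" where
  "borel_prob \<nu> \<longleftrightarrow> prob_space \<nu> \<and> sets \<nu> = sets borel"

text \<open>The dual Ruelle operator eigen-equation L^*\<nu> = \<lambda>\<nu>, where L^* is defined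
  by duality against continuous functions.\<close>
definition dual_eigen :: "('a::metric_space \<Rightarrow> 'a) \<Rightarrow> ('a \<Rightarrow> real) \<Rightarrow> 'a measure \<Rightarrow> real \<Rightarrow> bool" where
  "dual_eigen T \<psi> \<nu> l \<longleftrightarrow>
     (\<forall>f. continuous_on UNIV f \<longrightarrow>
        (\<integral>x. ruelle_op T \<psi> f x \<partial>\<nu>) = l * (\<integral>x. f x \<partial>\<nu>))"

definition unique_dual_eigen ::
  "nat \<Rightarrow> (nat \<Rightarrow> 'a::metric_space \<Rightarrow> 'a) \<Rightarrow> (nat \<Rightarrow> 'a \<Rightarrow> real) \<Rightarrow> bool" where
  "unique_dual_eigen k \<sigma> \<phi> \<longleftrightarrow>
     (\<exists>!(l, \<nu>). l \<in> {..<k} \<rightarrow>\<^sub>E {0<..} \<and> borel_prob \<nu> \<and>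
                (\<forall>i<k. dual_eigen (\<sigma> i) (\<phi> i) \<nu> (l i)))"

definition multi_idx :: "nat \<Rightarrow> (nat \<Rightarrow> nat) set" where
  "multi_idx k = {p. \<forall>i\<ge>k. p i = 0}"

fun siter :: "(nat \<Rightarrow> 'a \<Rightarrow> 'a) \<Rightarrow> nat \<Rightarrow> (nat \<Rightarrow> nat) \<Rightarrow> 'a \<Rightarrow> 'a" where
  "siter \<sigma> 0 p = id"
| "siter \<sigma> (Suc k) p = siter \<sigma> k p \<circ> (\<sigma> k ^^ p k)"

definition idx_diff :: "(nat \<Rightarrow> nat) \<Rightarrow> (nat \<Rightarrow> nat) \<Rightarrow> nat \<Rightarrow> int" where
  "idx_diff p q = (\<lambda>i. int (p i) - int (q i))"

type_synonym 'a garrow = "'a \<times> (nat \<Rightarrow> int) \<times> 'a"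

definition groupoid :: "nat \<Rightarrow> (nat \<Rightarrow> 'a \<Rightarrow> 'a) \<Rightarrow> 'a garrow set" where
  "groupoid k \<sigma> = {(x, n, y) | x n y. \<exists>p\<in>multi_idx k. \<exists>q\<in>multi_idx k.
                     siter \<sigma> k p x = siter \<sigma> k q y \<and> n = idx_diff p q}"

definition basic_opens :: "nat \<Rightarrow> (nat \<Rightarrow> 'a::topological_space \<Rightarrow> 'a) \<Rightarrow> 'a garrow set set" where
  "basic_opens k \<sigma> = {{(x, idx_diff p q, y) | x y. x \<in> U \<and> y \<in> V \<and> siter \<sigma> k p x = siter \<sigma> k q y}
      | U V p q. open U \<and> open V \<and> p \<in> multi_idx k \<and> q \<in> multi_idx k \<and>
                 inj_on (siter \<sigma> k p) U \<and> inj_on (siter \<sigma> k q) V \<and>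
                 siter \<sigma> k p ` U = siter \<sigma> k q ` V}"

definition groupoid_top :: "nat \<Rightarrow> (nat \<Rightarrow> 'a::topological_space \<Rightarrow> 'a) \<Rightarrow> 'a garrow topology" where
  "groupoid_top k \<sigma> = topology_generated_by (basic_opens k \<sigma>)"

definition g_src :: "'a garrow \<Rightarrow> 'a" where "g_src \<gamma> = snd (snd \<gamma>)"
definition g_rng :: "'a garrow \<Rightarrow> 'a" where "g_rng \<gamma> = fst \<gamma>"

text \<open>s^*mu and r^*mu on the Borel sets of the groupoid; the sum of indicators over
  G_x (resp. G^x) is the counting measure of B intersected with G_x (resp. G^x).\<close>
definition src_pull :: "nat \<Rightarrow> (nat \<Rightarrow> 'a::topological_space \<Rightarrow> 'a) \<Rightarrow> 'a measure \<Rightarrow> 'a garrow measure" where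
  "src_pull k \<sigma> \<mu> = measure_of (groupoid k \<sigma>) {B. openin (groupoid_top k \<sigma>) B}
     (\<lambda>B. \<integral>\<^sup>+ x. emeasure (count_space UNIV) {\<gamma> \<in> groupoid k \<sigma>. g_src \<gamma> = x \<and> \<gamma> \<in> B} \<partial>\<mu>)"

definition rng_pull :: "nat \<Rightarrow> (nat \<Rightarrow> 'a::topological_space \<Rightarrow> 'a) \<Rightarrow> 'a measure \<Rightarrow> 'a garrow measure" where
  "rng_pull k \<sigma> \<mu> = measure_of (groupoid k \<sigma>) {B. openin (groupoid_top k \<sigma>) B}
     (\<lambda>B. \<integral>\<^sup>+ x. emeasure (count_space UNIV) {\<gamma> \<in> groupoid k \<sigma>. g_rng \<gamma> = x \<and> \<gamma> \<in> B} \<partial>\<mu>)"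

definition unit_vec :: "nat \<Rightarrow> nat \<Rightarrow> int" where
  "unit_vec i = (\<lambda>j. if j = i then 1 else 0)"

text \<open>c is the (unique) continuous groupoid homomorphism with
  c(x, e_i, sigma_i x) = phi_i x.\<close>
definition is_cocycle_c :: "nat \<Rightarrow> (nat \<Rightarrow> 'a::topological_space \<Rightarrow> 'a) \<Rightarrow> (nat \<Rightarrow> 'a \<Rightarrow> real)
     \<Rightarrow> ('a garrow \<Rightarrow> real) \<Rightarrow> bool" where
  "is_cocycle_c k \<sigma> \<phi> c \<longleftrightarrow>
     continuous_map (groupoid_top k \<sigma>) euclideanreal c \<and>
     (\<forall>x m y n z. (x, m, y) \<in> groupoid k \<sigma> \<longrightarrow> (y, n, z) \<in> groupoid k \<sigma> \<longrightarrow>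
        c (x, \<lambda>i. m i + n i, z) = c (x, m, y) + c (y, n, z)) \<and>
     (\<forall>i<k. \<forall>x. c (x, unit_vec i, \<sigma> i x) = \<phi> i x)"

end

theory Submission
  imports Defs
begin

text \<open>
  For a countable-to-one map \<open>r\<close> write \<open>r\<^sub>* h\<close> for the sum of \<open>h\<close> over the fibres of \<open>r\<close>. Then
  \<open>\<integral> h d(r\<^sup>*\<mu>) = \<integral> r\<^sub>* h d\<mu>\<close>, the Ruelle operator is \<open>f \<mapsto> T\<^sub>* (e\<^sup>\<psi> f)\<close>, and fibre sums are
  functorial: \<open>(T \<circ> r)\<^sub>* = T\<^sub>* \<circ> r\<^sub>*\<close>. Condition (1) says \<open>r\<^sup>*\<mu> = e\<^sup>c s\<^sup>*\<mu>\<close>; condition (2), extended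
  from continuous to nonnegative Borel functions, says \<open>\<integral> (\<sigma>\<^sub>i)\<^sub>* (e\<^bsup>\<phi>\<^sub>i\<^esup> f) d\<mu> = \<integral> f d\<mu>\<close>.

  Condition (2) passes to all compositions \<open>\<sigma>\<^sup>p\<close> with weight \<open>\<phi>\<^sup>p(x) = c(x, p, \<sigma>\<^sup>p x)\<close>. On the open set
  of arrows \<open>(x, p - q, y)\<close> with \<open>\<sigma>\<^sup>p x = \<sigma>\<^sup>q y\<close> one has \<open>\<sigma>\<^sup>p \<circ> r = \<sigma>\<^sup>q \<circ> s\<close> and \<open>\<phi>\<^sup>p \<circ> r = c + \<phi>\<^sup>q \<circ> s\<close>, so
  for \<open>B\<close> inside it both \<open>r\<^sup>*\<mu>\<close> and \<open>e\<^sup>c s\<^sup>*\<mu>\<close> give \<open>B\<close> the measure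
  \<open>\<integral> (\<sigma>\<^sup>p \<circ> r)\<^sub>* (1\<^sub>B e\<^bsup>\<phi>\<^sup>p \<circ> r\<^esup>) d\<mu>\<close>. Conversely, restricting \<open>r\<^sup>*\<mu> = e\<^sup>c s\<^sup>*\<mu>\<close> to the arrows
  \<open>(x, e\<^sub>i, \<sigma>\<^sub>i x)\<close> gives (2) for \<open>\<sigma>\<^sub>i\<close>.
\<close>

subsection \<open>Fibre sums and pulled-back measures\<close>

text \<open>Integrating against counting measure over the whole type, with an indicator for the
  fibre, makes the sum meaningful for infinite fibres too and turns exchange of sums into Tonelli's
  theorem.\<close>

definition fsum :: "('g \<Rightarrow> 'a) \<Rightarrow> ('g \<Rightarrow> ennreal) \<Rightarrow> 'a \<Rightarrow> ennreal" where
  "fsum r h x = (\<integral>\<^sup>+\<gamma>. h \<gamma> * indicator (r -` {x}) \<gamma> \<partial>count_space UNIV)"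

lemma fsum_cong: "(\<And>\<gamma>. r \<gamma> = x \<Longrightarrow> h \<gamma> = h' \<gamma>) \<Longrightarrow> fsum r h x = fsum r h' x"
  unfolding fsum_def by (intro nn_integral_cong) (auto split: split_indicator)

text \<open>On the arrows of a piece of degree p - q the composites with range and source agree, but
  only there; this lemma swaps them under a function supported on that piece.\<close>

lemma fsum_cong_support:
  assumes "\<And>\<gamma>. h \<gamma> \<noteq> 0 \<Longrightarrow> r \<gamma> = r' \<gamma>"
  shows "fsum r h = fsum r' h"
proof
  fix x
  have "h \<gamma> * indicator (r -` {x}) \<gamma> = h \<gamma> * indicator (r' -` {x}) \<gamma>" for \<gamma>
    using assms[of \<gamma>] by (cases "h \<gamma> = 0") (auto split: split_indicator)
  then show "fsum r h x = fsum r' h x"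
    unfolding fsum_def by simp
qed

text \<open>Projection formula: a factor pulled back along \<open>r\<close> is constant on each
  fibre.\<close>

lemma fsum_cmult_fibre: "fsum r (\<lambda>\<gamma>. w (r \<gamma>) * h \<gamma>) x = w x * fsum r h x"
proof -
  have "fsum r (\<lambda>\<gamma>. w (r \<gamma>) * h \<gamma>) x = fsum r (\<lambda>\<gamma>. w x * h \<gamma>) x"
    by (rule fsum_cong) simp
  also have "\<dots> = w x * fsum r h x"
    unfolding fsum_def by (simp add: nn_integral_cmult mult.assoc)
  finally show ?thesis .
qed

lemma fsum_add: "fsum r (\<lambda>\<gamma>. h \<gamma> + h' \<gamma>) x = fsum r h x + fsum r h' x"
  unfolding fsum_def by (simp add: distrib_right nn_integral_add)

lemma fsum_SUP:
  assumes "incseq U"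
  shows "fsum r (\<lambda>\<gamma>. SUP i. U i \<gamma>) x = (SUP i. fsum r (U i) x)"
proof -
  have "fsum r (\<lambda>\<gamma>. SUP i. U i \<gamma>) x =
      (\<integral>\<^sup>+\<gamma>. (SUP i. U i \<gamma> * indicator (r -` {x}) \<gamma>) \<partial>count_space UNIV)"
    unfolding fsum_def by (intro nn_integral_cong) (auto split: split_indicator)
  also have "\<dots> = (SUP i. fsum r (U i) x)"
    unfolding fsum_def
    using assms by (intro nn_integral_monotone_convergence_SUP)
      (auto simp: incseq_def le_fun_def split: split_indicator)
  finally show ?thesis .
qed

lemma fsum_mono: "(\<And>\<gamma>. h \<gamma> \<le> h' \<gamma>) \<Longrightarrow> fsum r h x \<le> fsum r h' x"
  unfolding fsum_def by (intro nn_integral_mono mult_right_mono) auto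

lemma fsum_suminf: "fsum r (\<lambda>\<gamma>. \<Sum>i. h i \<gamma>) x = (\<Sum>i. fsum r (h i) x)"
  unfolding fsum_def by (subst nn_integral_suminf[symmetric]) simp_all

text \<open>Tonelli for counting measures on the graph of \<open>r\<close>: a fibre of the composite
  is the disjoint union of the fibres of \<open>r\<close> over the points of a fibre of
  \<open>f\<close>.\<close>

lemma fsum_comp: "fsum (\<lambda>\<gamma>. f (r \<gamma>)) h z = fsum f (fsum r h) z"
proof -
  have "fsum f (fsum r h) z =
    (\<integral>\<^sup>+x. \<integral>\<^sup>+\<gamma>. (\<lambda>(x, \<gamma>). h \<gamma> * indicator {r \<gamma>} x * indicator (f -` {z}) x) (x, \<gamma>)
       \<partial>count_space UNIV \<partial>count_space UNIV)"
    unfolding fsum_def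
    by (intro nn_integral_cong) (auto split: split_indicator intro!: nn_integral_cong)
  also have "\<dots> =
    (\<integral>\<^sup>+\<gamma>. \<integral>\<^sup>+x. (\<lambda>(x, \<gamma>). h \<gamma> * indicator {r \<gamma>} x * indicator (f -` {z}) x) (x, \<gamma>)
       \<partial>count_space UNIV \<partial>count_space UNIV)"
    by (subst nn_integral_fst_count_space, subst nn_integral_snd_count_space) simp
  also have "\<dots> = (\<integral>\<^sup>+\<gamma>. h \<gamma> * indicator ((\<lambda>\<gamma>. f (r \<gamma>)) -` {z}) \<gamma> \<partial>count_space UNIV)"
  \<comment> \<open>For fixed \<gamma> only the point \<open>x = r \<gamma>\<close> contributes to
    the inner sum.\<close>
  proof (intro nn_integral_cong)
    fix \<gamma>
    have "(\<integral>\<^sup>+x. h \<gamma> * indicator {r \<gamma>} x * indicator (f -` {z}) x \<partial>count_space UNIV)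
       = (\<integral>\<^sup>+x. (h \<gamma> * indicator (f -` {z}) (r \<gamma>)) * indicator {r \<gamma>} x \<partial>count_space UNIV)"
      by (intro nn_integral_cong) (auto split: split_indicator)
    also have "\<dots> = h \<gamma> * indicator (f -` {z}) (r \<gamma>)"
      by (subst nn_integral_cmult) auto
    finally show "(\<integral>\<^sup>+x. (\<lambda>(x, \<gamma>). h \<gamma> * indicator {r \<gamma>} x * indicator (f -` {z}) x) (x, \<gamma>)
        \<partial>count_space UNIV) = h \<gamma> * indicator ((\<lambda>\<gamma>. f (r \<gamma>)) -` {z}) \<gamma>"
      by (simp add: indicator_def)
  qed
  finally show ?thesis
    unfolding fsum_def by simp
qed

text \<open>An injective piece meets each fibre at most once. This reduces measurability of fibre
  sums to measurability of images.\<close>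

lemma fsum_indicator_inj:
  assumes "inj_on r C"
  shows "fsum r (indicator C) x = indicator (r ` C) x"
proof (cases "x \<in> r ` C")
  case True
  then obtain \<gamma> where \<gamma>: "\<gamma> \<in> C" "x = r \<gamma>" by auto
  have "indicator C \<delta> * indicator (r -` {x}) \<delta> = (indicator {\<gamma>} \<delta> :: ennreal)" for \<delta>
    using \<gamma> inj_onD[OF assms, of \<delta> \<gamma>] by (auto split: split_indicator)
  then show ?thesis
    using True unfolding fsum_def by simp
next
  case False
  then have "(\<lambda>\<delta>. indicator C \<delta> * indicator (r -` {x}) \<delta>) = (\<lambda>_. 0 :: ennreal)"
    by (auto simp: fun_eq_iff indicator_def)
  then show ?thesis
    using False unfolding fsum_def by simp
qed

lemma fsum_eq_sum:
  assumes "finite (r -` {x})"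
  shows "fsum r h x = (\<Sum>\<gamma>\<in>{\<gamma>. r \<gamma> = x}. h \<gamma>)"
proof -
  have "fsum r h x = (\<integral>\<^sup>+\<gamma>. h \<gamma> \<partial>count_space (r -` {x}))"
    unfolding fsum_def by (simp add: nn_integral_count_space_indicator)
  also have "\<dots> = sum h (r -` {x})"
    using assms by (rule nn_integral_count_space_finite)
  finally show ?thesis
    by (simp add: vimage_def)
qed

text \<open>The common property of etale maps on X and of range and source on the groupoid that
  makes fibre sums measurable. Measurability of images is demanded outright, since a measurable
  injective map does not provide it in general.\<close>

definition countable_sections :: "'g measure \<Rightarrow> 'a measure \<Rightarrow> ('g \<Rightarrow> 'a) \<Rightarrow> bool" where
  "countable_sections M N r \<longleftrightarrow> (\<exists>\<W>. countable \<W> \<and> \<Union>\<W> = space M \<and>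
     (\<forall>W\<in>\<W>. W \<in> sets M \<and> inj_on r W \<and> (\<forall>B\<in>sets M. r ` (B \<inter> W) \<in> sets N)))"

lemma countable_sections_disjoint:
  fixes M :: "'g measure"
  assumes "countable_sections M N r"
  shows "\<exists>D :: nat \<Rightarrow> 'g set. disjoint_family D \<and> (\<Union>i. D i) = space M \<and>
    (\<forall>i. D i \<in> sets M \<and> inj_on r (D i) \<and> (\<forall>B\<in>sets M. r ` (B \<inter> D i) \<in> sets N))"
proof -
  obtain \<W> where \<W>: "countable \<W>" "\<Union>\<W> = space M"
    "\<forall>W\<in>\<W>. W \<in> sets M \<and> inj_on r W \<and> (\<forall>B\<in>sets M. r ` (B \<inter> W) \<in> sets N)"
    using assms unfolding countable_sections_def by blast
  \<comment> \<open>The empty set is added so that the enumerated family is nonempty even when the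
    cover is empty.\<close>
  define W where "W = from_nat_into (insert {} \<W>)"
  have rW: "range W = insert {} \<W>"
    unfolding W_def using \<W>(1) by (intro range_from_nat_into) auto
  have W: "W i \<in> sets M \<and> inj_on r (W i) \<and> (\<forall>B\<in>sets M. r ` (B \<inter> W i) \<in> sets N)" for i
  proof -
    have "W i \<in> insert {} \<W>" using rW by blast
    then show ?thesis using \<W>(3) by auto
  qed
  have D: "disjointed W i \<in> sets M" for i
    using sets.range_disjointed_sets[of W M] W by auto
  have "inj_on r (disjointed W i)" for i
    using W[of i] by (intro inj_on_subset[OF _ disjointed_subset]) simp
  moreover have "r ` (B \<inter> disjointed W i) \<in> sets N" if "B \<in> sets M" for i B
  proof -
    have "B \<inter> disjointed W i \<in> sets M"
      using that D[of i] by simp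
    then have "r ` (B \<inter> disjointed W i \<inter> W i) \<in> sets N"
      using W[of i] by simp
    moreover have "B \<inter> disjointed W i \<inter> W i = B \<inter> disjointed W i"
      using disjointed_subset[of W i] by auto
    ultimately show ?thesis by simp
  qed
  moreover have "(\<Union>i. disjointed W i) = space M"
    using rW \<W>(2) by (simp add: UN_disjointed_eq)
  ultimately show ?thesis
    using D disjoint_family_disjointed[of W] by (intro exI[of _ "disjointed W"]) simp
qed

text \<open>Cut \<open>B\<close> along the disjoint injective pieces: on each of them the fibre sum
  is the indicator of a measurable image, and countably many of these add up.\<close>

lemma fsum_indicator_measurable:
  assumes cs: "countable_sections M N r" and B: "B \<in> sets M"
  shows "fsum r (indicator B) \<in> borel_measurable N"
proof -
  obtain D :: "nat \<Rightarrow> _" where D: "disjoint_family D" "(\<Union>i. D i) = space M" 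
    "\<forall>i. D i \<in> sets M \<and> inj_on r (D i) \<and> (\<forall>B\<in>sets M. r ` (B \<inter> D i) \<in> sets N)"
    using countable_sections_disjoint[OF cs] by blast
  have "(\<Sum>i. indicator (B \<inter> D i) \<gamma>) = (indicator B \<gamma> :: ennreal)" for \<gamma>
  proof -
    have "(\<Union>i. B \<inter> D i) = B"
      using D(2) sets.sets_into_space[OF B] by auto
    moreover have "disjoint_family (\<lambda>i. B \<inter> D i)"
      using D(1) by (auto simp: disjoint_family_on_def)
    ultimately show ?thesis
      using suminf_indicator[of "\<lambda>i. B \<inter> D i" \<gamma>] by simp
  qed
  then have "fsum r (indicator B) x = fsum r (\<lambda>\<gamma>. \<Sum>i. indicator (B \<inter> D i) \<gamma>) x" for x
    by simp
  also have "\<dots> x = (\<Sum>i. indicator (r ` (B \<inter> D i)) x)" for x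
    using D(3) by (simp add: fsum_suminf fsum_indicator_inj inj_on_subset[OF _ Int_lower2])
  finally have "fsum r (indicator B) = (\<lambda>x. \<Sum>i. indicator (r ` (B \<inter> D i)) x)"
    by auto
  then show ?thesis
    using D(3) B by (auto intro!: borel_measurable_suminf_order borel_measurable_indicator)
qed

text \<open>The indicator of the space is present because measurability controls \<open>h\<close>
  only on \<open>space M\<close>, whereas the fibre sum runs over the whole type.\<close>

lemma fsum_measurable:
  assumes cs: "countable_sections M N r" and h: "h \<in> borel_measurable M"
  shows "fsum r (\<lambda>\<gamma>. h \<gamma> * indicator (space M) \<gamma>) \<in> borel_measurable N"
  using h
proof (induction rule: borel_measurable_induct)
  case (cong f g)
  then have "(\<lambda>\<gamma>. f \<gamma> * indicator (space M) \<gamma>) = (\<lambda>\<gamma>. g \<gamma> * indicator (space M) \<gamma>)"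
    by (auto simp: fun_eq_iff indicator_def)
  with cong show ?case by metis
next
  case (set A)
  then have "(\<lambda>\<gamma>. indicator A \<gamma> * indicator (space M) \<gamma> :: ennreal) = indicator A"
    using sets.sets_into_space[OF set] by (auto simp: fun_eq_iff indicator_def)
  then show ?case
    using fsum_indicator_measurable[OF cs set] by simp
next
  case (mult u c)
  have "fsum r (\<lambda>\<gamma>. c * u \<gamma> * indicator (space M) \<gamma>) x = c * fsum r (\<lambda>\<gamma>. u \<gamma> * indicator (space M) \<gamma>) x" for x
    using fsum_cmult_fibre[of r "\<lambda>_. c"] by (simp add: mult.assoc)
  then show ?case
    using mult by simp
next
  case (add u v)
  then show ?case
    by (simp add: distrib_right fsum_add)
next
  case (seq U)
  have "incseq (\<lambda>i \<gamma>. U i \<gamma> * indicator (space M) \<gamma>)"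
    using seq by (auto simp: incseq_def le_fun_def split: split_indicator)
  moreover have "(SUP i. U i) \<gamma> * indicator (space M) \<gamma> = (SUP i. U i \<gamma> * indicator (space M) \<gamma>)" for \<gamma>
    by (auto simp: image_comp split: split_indicator)
  ultimately have "fsum r (\<lambda>\<gamma>. (SUP i. U i) \<gamma> * indicator (space M) \<gamma>) x =
      (SUP i. fsum r (\<lambda>\<gamma>. U i \<gamma> * indicator (space M) \<gamma>) x)" for x
    by (simp add: fsum_SUP)
  then show ?case
    using seq by simp
qed

text \<open>The measure written r^*\<mu> in the overview, for any measurable space in place of the
  groupoid. Range and source give \<open>rng_pull\<close> and \<open>src_pull\<close>; an etale
  self-map of X gives the measure behind the dual Ruelle operator.\<close>

definition pullback_measure :: "'g measure \<Rightarrow> ('g \<Rightarrow> 'a) \<Rightarrow> 'a measure \<Rightarrow> 'g measure" where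
  "pullback_measure M r \<mu> = measure_of (space M) (sets M) (\<lambda>B. \<integral>\<^sup>+x. fsum r (indicator B) x \<partial>\<mu>)"

lemma sets_pullback_measure [simp, measurable_cong]: "sets (pullback_measure M r \<mu>) = sets M"
  by (simp add: pullback_measure_def)

lemma space_pullback_measure [simp]: "space (pullback_measure M r \<mu>) = space M"
  by (simp add: pullback_measure_def)

lemma countably_additive_fsum:
  assumes cs: "countable_sections M \<mu> r"
  shows "countably_additive (sets M) (\<lambda>B. \<integral>\<^sup>+x. fsum r (indicator B) x \<partial>\<mu>)"
proof (rule countably_additiveI)
  fix A :: "nat \<Rightarrow> _" assume A: "range A \<subseteq> sets M" "disjoint_family A"
  have "indicator (\<Union>i. A i) = (\<lambda>\<gamma>. \<Sum>i. indicator (A i) \<gamma> :: ennreal)"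
    using suminf_indicator[OF A(2)] by (auto simp: fun_eq_iff)
  then have "fsum r (indicator (\<Union>i. A i)) x = (\<Sum>i. fsum r (indicator (A i)) x)" for x
    using fsum_suminf[of r "\<lambda>i. indicator (A i)" x] by simp
  then show "(\<Sum>i. \<integral>\<^sup>+x. fsum r (indicator (A i)) x \<partial>\<mu>) = (\<integral>\<^sup>+x. fsum r (indicator (\<Union>i. A i)) x \<partial>\<mu>)"
    using A fsum_indicator_measurable[OF cs]
    by (simp add: nn_integral_suminf image_subset_iff)
qed

lemma positive_fsum: "positive \<A> (\<lambda>B. \<integral>\<^sup>+x. fsum r (indicator B) x \<partial>\<mu>)"
  by (simp add: positive_def fsum_def)

lemma emeasure_pullback_measure:
  assumes cs: "countable_sections M \<mu> r" and B: "B \<in> sets M"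
  shows "emeasure (pullback_measure M r \<mu>) B = (\<integral>\<^sup>+x. fsum r (indicator B) x \<partial>\<mu>)"
  using B countably_additive_fsum[OF cs]
  by (intro emeasure_measure_of[OF pullback_measure_def])
    (simp_all add: positive_fsum sets.space_closed)

text \<open>For indicators this is the definition; linearity and monotone limits pass through the
  fibre sum and, since fibre sums are measurable, through the outer integral.\<close>

lemma nn_integral_pullback_measure:
  assumes cs: "countable_sections M \<mu> r" and h: "h \<in> borel_measurable M"
  shows "(\<integral>\<^sup>+\<gamma>. h \<gamma> \<partial>pullback_measure M r \<mu>) =
    (\<integral>\<^sup>+x. fsum r (\<lambda>\<gamma>. h \<gamma> * indicator (space M) \<gamma>) x \<partial>\<mu>)"
  using h
proof (induction rule: borel_measurable_induct)
  case (cong f g)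
  then have "(\<lambda>\<gamma>. f \<gamma> * indicator (space M) \<gamma>) = (\<lambda>\<gamma>. g \<gamma> * indicator (space M) \<gamma>)"
    by (auto simp: fun_eq_iff indicator_def)
  moreover have "(\<integral>\<^sup>+\<gamma>. f \<gamma> \<partial>pullback_measure M r \<mu>) = (\<integral>\<^sup>+\<gamma>. g \<gamma> \<partial>pullback_measure M r \<mu>)"
    using cong by (intro nn_integral_cong) simp
  ultimately show ?case using cong by metis
next
  case (set A)
  then have "(\<lambda>\<gamma>. indicator A \<gamma> * indicator (space M) \<gamma> :: ennreal) = indicator A"
    using sets.sets_into_space[OF set] by (auto simp: fun_eq_iff indicator_def)
  then show ?case
    using emeasure_pullback_measure[OF cs set] set by simp
next
  case (mult u c)
  have "fsum r (\<lambda>\<gamma>. c * u \<gamma> * indicator (space M) \<gamma>) x = c * fsum r (\<lambda>\<gamma>. u \<gamma> * indicator (space M) \<gamma>) x" for x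
    using fsum_cmult_fibre[of r "\<lambda>_. c"] by (simp add: mult.assoc)
  moreover have "u \<in> borel_measurable (pullback_measure M r \<mu>)"
    using mult by (simp cong: measurable_cong_sets)
  ultimately show ?case
    using mult fsum_measurable[OF cs, of u] by (simp add: nn_integral_cmult)
next
  case (add u v)
  moreover have "u \<in> borel_measurable (pullback_measure M r \<mu>)" "v \<in> borel_measurable (pullback_measure M r \<mu>)"
    using add by (simp_all cong: measurable_cong_sets)
  ultimately show ?case
    using fsum_measurable[OF cs, of u] fsum_measurable[OF cs, of v]
    by (simp add: distrib_right fsum_add nn_integral_add)
next
  case (seq U)
  have inc: "incseq (\<lambda>i \<gamma>. U i \<gamma> * indicator (space M) \<gamma>)"
    using seq by (auto simp: incseq_def le_fun_def split: split_indicator)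
  have eq: "(SUP i. U i) \<gamma> * indicator (space M) \<gamma> = (SUP i. U i \<gamma> * indicator (space M) \<gamma>)" for \<gamma>
    by (auto simp: image_comp split: split_indicator)
  have "(\<integral>\<^sup>+\<gamma>. (SUP i. U i) \<gamma> \<partial>pullback_measure M r \<mu>) =
      (SUP i. \<integral>\<^sup>+\<gamma>. U i \<gamma> \<partial>pullback_measure M r \<mu>)"
    using seq nn_integral_monotone_convergence_SUP[of U "pullback_measure M r \<mu>"]
    by (simp add: image_comp cong: measurable_cong_sets)
  also have "\<dots> = (SUP i. \<integral>\<^sup>+x. fsum r (\<lambda>\<gamma>. U i \<gamma> * indicator (space M) \<gamma>) x \<partial>\<mu>)"
    using seq by simp
  also have "\<dots> = (\<integral>\<^sup>+x. (SUP i. fsum r (\<lambda>\<gamma>. U i \<gamma> * indicator (space M) \<gamma>) x) \<partial>\<mu>)"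
  proof (rule nn_integral_monotone_convergence_SUP[symmetric])
    show "incseq (\<lambda>i. fsum r (\<lambda>\<gamma>. U i \<gamma> * indicator (space M) \<gamma>))"
      using inc by (auto simp: incseq_def le_fun_def intro!: fsum_mono)
    show "fsum r (\<lambda>\<gamma>. U i \<gamma> * indicator (space M) \<gamma>) \<in> borel_measurable \<mu>" for i
      using seq by (intro fsum_measurable[OF cs])
  qed
  also have "\<dots> = (\<integral>\<^sup>+x. fsum r (\<lambda>\<gamma>. (SUP i. U i) \<gamma> * indicator (space M) \<gamma>) x \<partial>\<mu>)"
    unfolding eq fsum_SUP[OF inc] ..
  finally show ?case .
qed

text \<open>Each injective piece has mass at most that of \<mu>. Sigma-finiteness gives existence
  and uniqueness of the Radon-Nikodym derivative later on.\<close>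

lemma sigma_finite_pullback_measure:
  assumes cs: "countable_sections M \<mu> r" and fin: "finite_measure \<mu>"
  shows "sigma_finite_measure (pullback_measure M r \<mu>)"
proof
  obtain D :: "nat \<Rightarrow> _" where D: "disjoint_family D" "(\<Union>i. D i) = space M" 
    "\<forall>i. D i \<in> sets M \<and> inj_on r (D i) \<and> (\<forall>B\<in>sets M. r ` (B \<inter> D i) \<in> sets \<mu>)"
    using countable_sections_disjoint[OF cs] by blast
  have "emeasure (pullback_measure M r \<mu>) (D i) \<noteq> \<infinity>" for i
  proof -
    have "emeasure (pullback_measure M r \<mu>) (D i) = (\<integral>\<^sup>+x. indicator (r ` D i) x \<partial>\<mu>)"
      using D by (simp add: emeasure_pullback_measure[OF cs] fsum_indicator_inj)
    also have "\<dots> \<le> (\<integral>\<^sup>+x. 1 \<partial>\<mu>)"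
      by (intro nn_integral_mono) (auto split: split_indicator)
    also have "\<dots> < \<infinity>"
      using finite_measure.finite_emeasure_space[OF fin] by (simp add: less_top)
    finally show ?thesis by simp
  qed
  then show "\<exists>A. countable A \<and> A \<subseteq> sets (pullback_measure M r \<mu>) \<and>
      \<Union>A = space (pullback_measure M r \<mu>) \<and> (\<forall>a\<in>A. emeasure (pullback_measure M r \<mu>) a \<noteq> \<infinity>)"
    using D by (intro exI[of _ "range D"]) auto
qed

text \<open>Injectivity on \<open>W\<close> makes images commute with complements, so the sets with
  measurable image form a sigma-algebra and generators decide.\<close>

lemma inj_image_in_sets:
  assumes inj: "inj_on r W" and W: "W \<subseteq> \<Omega>" "r ` W \<in> sets N"
    and gen: "\<And>A. A \<in> \<A> \<Longrightarrow> r ` (A \<inter> W) \<in> sets N"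
    and B: "B \<in> sigma_sets \<Omega> \<A>"
  shows "r ` (B \<inter> W) \<in> sets N"
  using B
proof induction
  case (Basic a)
  then show ?case by (rule gen)
next
  case Empty
  then show ?case by simp
next
  case (Compl a)
  have "r ` ((\<Omega> - a) \<inter> W) = r ` W - r ` (a \<inter> W)"
    using W inj by (auto simp: inj_on_def)
  then show ?case
    using Compl W by auto
next
  case (Union a)
  have "r ` (\<Union> (range a) \<inter> W) = (\<Union>i. r ` (a i \<inter> W))" by auto
  then show ?case
    using Union by auto
qed

subsection \<open>Local homeomorphisms and the dual Ruelle operator\<close>

text \<open>Local homeomorphisms without local inverses: continuous, open and locally injective. In
  this form the notion passes easily to compositions.\<close>

definition etale :: "('a::topological_space \<Rightarrow> 'a) \<Rightarrow> bool" where
  "etale T \<longleftrightarrow> continuous_on UNIV T \<and> (\<forall>U. open U \<longrightarrow> open (T ` U)) \<and>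
     (\<forall>x. \<exists>U. open U \<and> x \<in> U \<and> inj_on T U)"

text \<open>Only openness needs an argument: near \<open>y\<close> the preimage of \<open>S\<close>
  under the continuous local inverse is an open neighbourhood inside the image of
  \<open>S\<close>.\<close>

lemma local_homeo_imp_etale:
  assumes "local_homeo T"
  shows "etale T"
proof -
  have T: "\<exists>U. open U \<and> x \<in> U \<and> inj_on T U \<and> open (T ` U) \<and> continuous_on (T ` U) (inv_into U T)" for x
    using assms unfolding local_homeo_def by blast
  have "open (T ` S)" if S: "open S" for S
  proof (subst open_subopen, intro ballI)
    fix y assume "y \<in> T ` S"
    then obtain x where x: "x \<in> S" "y = T x" by auto
    obtain U where U: "open U" "x \<in> U" "inj_on T U" "open (T ` U)"
      "continuous_on (T ` U) (inv_into U T)" using T[of x] by blast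
    have "open (inv_into U T -` S \<inter> T ` U)"
      using continuous_on_open_vimage[OF U(4)] U(5) S by blast
    moreover have "inv_into U T -` S \<inter> T ` U \<subseteq> T ` S"
      using U(3) by (auto simp: image_iff) 
    moreover have "y \<in> inv_into U T -` S \<inter> T ` U"
      using x U by auto
    ultimately show "\<exists>V. open V \<and> y \<in> V \<and> V \<subseteq> T ` S" by blast
  qed
  then show ?thesis
    using assms T unfolding etale_def local_homeo_def by blast
qed

lemma etale_id: "etale id"
  unfolding etale_def by (auto intro: exI[of _ UNIV])

lemma etale_comp:
  assumes "etale S" "etale T"
  shows "etale (S \<circ> T)"
  unfolding etale_def
proof (intro conjI allI impI)
  show "continuous_on UNIV (S \<circ> T)"
    using assms unfolding etale_def by (intro continuous_on_compose) (auto intro: continuous_on_subset)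
  show "open ((S \<circ> T) ` U)" if "open U" for U
    using assms that unfolding etale_def image_comp[symmetric] by blast
  fix x
  obtain U V where UV: "open U" "x \<in> U" "inj_on T U" "open V" "T x \<in> V" "inj_on S V"
    using assms unfolding etale_def by blast
  have "open (U \<inter> T -` V)"
    using assms UV unfolding etale_def by (auto intro: open_vimage)
  moreover have "inj_on (S \<circ> T) (U \<inter> T -` V)"
    using UV by (intro comp_inj_on inj_on_subset[OF UV(3)] inj_on_subset[OF UV(6)]) auto
  ultimately show "\<exists>U. open U \<and> x \<in> U \<and> inj_on (S \<circ> T) U"
    using UV by blast
qed

lemma etale_finite_cover:
  fixes T :: "'a::topological_space \<Rightarrow> 'a"
  assumes "compact (UNIV :: 'a set)" "etale T"
  shows "\<exists>\<U>. finite \<U> \<and> \<Union>\<U> = UNIV \<and> (\<forall>U\<in>\<U>. open U \<and> inj_on T U)"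
proof -
  let ?C = "{U. open U \<and> inj_on T U}"
  have "UNIV \<subseteq> \<Union>?C" using assms(2) unfolding etale_def by blast
  then obtain \<U> where "\<U> \<subseteq> ?C" "finite \<U>" "UNIV \<subseteq> \<Union>\<U>"
    using compactE[OF assms(1), of ?C] by blast
  then show ?thesis by blast
qed

lemma sets_borel_sigma_sets: "sets borel = sigma_sets UNIV {S :: 'a::topological_space set. open S}"
  by (simp add: borel_def)

lemma countable_sections_etale:
  fixes T :: "'a::topological_space \<Rightarrow> 'a"
  assumes "compact (UNIV :: 'a set)" "etale T" and \<mu>: "sets \<mu> = sets borel"
  shows "countable_sections borel \<mu> T"
proof -
  obtain \<U> where \<U>: "finite \<U>" "\<Union>\<U> = UNIV" "\<forall>U\<in>\<U>. open U \<and> inj_on T U"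
    using etale_finite_cover[OF assms(1,2)] by blast
  have op: "\<And>U. open U \<Longrightarrow> open (T ` U)" using assms(2) unfolding etale_def by blast
  have "T ` (B \<inter> U) \<in> sets \<mu>" if "U \<in> \<U>" "B \<in> sets borel" for U B
    unfolding \<mu>
  proof (rule inj_image_in_sets)
    show "inj_on T U" "U \<subseteq> UNIV" "T ` U \<in> sets borel"
      using that \<U> op by auto
    show "T ` (A \<inter> U) \<in> sets borel" if "A \<in> {S. open S}" for A
      using that \<open>U \<in> \<U>\<close> \<U> by (intro borel_open op open_Int) auto
    show "B \<in> sigma_sets UNIV {S. open S}"
      using that sets_borel_sigma_sets by blast
  qed
  then show ?thesis
    unfolding countable_sections_def using \<U>
    by (intro exI[of _ \<U>]) (auto simp: countable_finite)
qed

lemma fsum_etale_measurable: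
  fixes T :: "'a::topological_space \<Rightarrow> 'a"
  assumes "compact (UNIV :: 'a set)" "etale T" "sets \<mu> = sets borel" "h \<in> borel_measurable borel"
  shows "fsum T h \<in> borel_measurable \<mu>"
  using fsum_measurable[OF countable_sections_etale[OF assms(1-3)] assms(4)] by simp

text \<open>Each member of a finite cover by injective sets meets a fibre at most once, so the size
  of the cover bounds all fibres simultaneously. The uniform bound makes the Ruelle operator
  bounded.\<close>

lemma etale_card_fibre:
  fixes T :: "'a::topological_space \<Rightarrow> 'a"
  assumes "compact (UNIV :: 'a set)" "etale T"
  shows "\<exists>N. \<forall>x. finite (T -` {x}) \<and> card (T -` {x}) \<le> N"
proof -
  obtain \<U> where \<U>: "finite \<U>" "\<Union>\<U> = UNIV" "\<forall>U\<in>\<U>. open U \<and> inj_on T U"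
    using etale_finite_cover[OF assms] by blast
  have "finite (T -` {x}) \<and> card (T -` {x}) \<le> card \<U>" for x
  proof -
    have U: "finite (U \<inter> T -` {x}) \<and> card (U \<inter> T -` {x}) \<le> 1" if "U \<in> \<U>" for U
    proof -
      have "inj_on T U" using \<U> that by blast
      then have "a = b" if "a \<in> U \<inter> T -` {x}" "b \<in> U \<inter> T -` {x}" for a b
        using that by (auto dest: inj_onD)
      then have "U \<inter> T -` {x} = {} \<or> (\<exists>a. U \<inter> T -` {x} = {a})" by blast
      then show ?thesis by (auto simp: card_insert_if)
    qed
    have eq: "T -` {x} = (\<Union>U\<in>\<U>. U \<inter> T -` {x})" using \<U>(2) by blast
    have "finite (T -` {x})" by (subst eq) (use U \<U>(1) in blast)
    moreover have "card (T -` {x}) \<le> (\<Sum>U\<in>\<U>. card (U \<inter> T -` {x}))"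
      by (subst eq) (rule card_UN_le[OF \<U>(1)])
    moreover have "\<dots> \<le> (\<Sum>U\<in>\<U>. 1)" using U by (intro sum_mono) blast
    ultimately show ?thesis by simp
  qed
  then show ?thesis by blast
qed

text \<open>The eigen-equation with eigenvalue 1, tested on nonnegative Borel functions instead of
  continuous ones; with values in \<open>ennreal\<close> no integrability enters.\<close>

definition transfer_invariant :: "'a::topological_space measure \<Rightarrow> ('a \<Rightarrow> 'a) \<Rightarrow> ('a \<Rightarrow> ennreal) \<Rightarrow> bool" where
  "transfer_invariant \<mu> T w \<longleftrightarrow> (\<forall>f\<in>borel_measurable borel.
     (\<integral>\<^sup>+x. fsum T (\<lambda>y. w y * f y) x \<partial>\<mu>) = (\<integral>\<^sup>+x. f x \<partial>\<mu>))"

text \<open>By functoriality and the projection formula the composite transfer of \<open>f\<close>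
  is the \<open>S\<close>-transfer of the \<open>T\<close>-transfer of \<open>f\<close>. Invariance
  under \<open>S\<close> is applied to that inner function, which is why it must be Borel, and then
  invariance under \<open>T\<close> to \<open>f\<close>.\<close>

lemma transfer_invariant_comp:
  fixes S T :: "'a::topological_space \<Rightarrow> 'a"
  assumes S: "transfer_invariant \<mu> S v" and T: "transfer_invariant \<mu> T w"
    and "compact (UNIV :: 'a set)" "etale T" and [measurable]: "w \<in> borel_measurable borel"
  shows "transfer_invariant \<mu> (S \<circ> T) (\<lambda>y. v (T y) * w y)"
  unfolding transfer_invariant_def
proof
  fix f :: "'a \<Rightarrow> ennreal" assume [measurable]: "f \<in> borel_measurable borel"
  let ?g = "fsum T (\<lambda>y. w y * f y)"
  have g: "?g \<in> borel_measurable borel"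
    using assms by (intro fsum_etale_measurable) auto
  have "fsum (S \<circ> T) (\<lambda>y. v (T y) * w y * f y) x = fsum S (\<lambda>z. v z * ?g z) x" for x
  proof -
    have "fsum (S \<circ> T) (\<lambda>y. v (T y) * w y * f y) x = fsum S (fsum T (\<lambda>y. v (T y) * (w y * f y))) x"
      unfolding comp_def by (subst fsum_comp) (simp add: mult.assoc)
    also have "fsum T (\<lambda>y. v (T y) * (w y * f y)) = (\<lambda>z. v z * ?g z)"
      by (rule ext) (rule fsum_cmult_fibre)
    finally show ?thesis .
  qed
  then show "(\<integral>\<^sup>+x. fsum (S \<circ> T) (\<lambda>y. v (T y) * w y * f y) x \<partial>\<mu>) = (\<integral>\<^sup>+x. f x \<partial>\<mu>)"
    using S T g \<open>f \<in> borel_measurable borel\<close> unfolding transfer_invariant_def by simp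
qed

lemma fsum_id: "fsum id f = f"
proof
  fix x
  have "f \<gamma> * indicator (id -` {x}) \<gamma> = f x * indicator {x} \<gamma>" for \<gamma>
    by (auto split: split_indicator)
  then show "fsum id f x = f x"
    unfolding fsum_def by (simp add: nn_integral_cmult)
qed

lemma transfer_invariant_id: "transfer_invariant \<mu> id (\<lambda>_. 1)"
  by (simp add: transfer_invariant_def fsum_id)

lemma ruelle_op_nonneg: "(\<And>y. 0 \<le> f y) \<Longrightarrow> 0 \<le> ruelle_op T \<psi> f x"
  unfolding ruelle_op_def by (intro sum_nonneg) auto

text \<open>Finiteness of the fibre matters: the real sum in \<open>ruelle_op\<close> over an
  infinite set would be 0 by convention.\<close>

lemma fsum_eq_ruelle_op:
  assumes "finite (T -` {x})" "\<And>y. 0 \<le> f y"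
  shows "fsum T (\<lambda>y. ennreal (exp (\<psi> y)) * ennreal (f y)) x = ennreal (ruelle_op T \<psi> f x)"
  using assms by (simp add: fsum_eq_sum ruelle_op_def ennreal_mult[symmetric])

section \<open>Passing between continuous test functions and nonnegative Borel ones\<close>

context
  fixes T :: "'a::metric_space \<Rightarrow> 'a" and \<psi> :: "'a \<Rightarrow> real" and \<mu> :: "'a measure"
  assumes compact: "compact (UNIV :: 'a set)" and T: "etale T"
    and \<psi>: "continuous_on UNIV \<psi>" and \<mu>: "borel_prob \<mu>"
begin

interpretation prob_space \<mu>
  using \<mu> by (simp add: borel_prob_def)

lemma sets_eq_borel: "sets \<mu> = sets borel"
  using \<mu> by (simp add: borel_prob_def)

lemma finite_fibre: "finite (T -` {x})"
  using etale_card_fibre[OF compact T] by blast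

lemma weight_measurable [measurable]: "(\<lambda>y. ennreal (exp (\<psi> y))) \<in> borel_measurable borel"
  using borel_measurable_continuous_onI[OF \<psi>] by measurable

lemma ruelle_op_measurable:
  assumes "f \<in> borel_measurable borel" "\<And>y. 0 \<le> f y"
  shows "ruelle_op T \<psi> f \<in> borel_measurable \<mu>"
proof -
  have "fsum T (\<lambda>y. ennreal (exp (\<psi> y)) * ennreal (f y)) \<in> borel_measurable \<mu>"
    using assms by (intro fsum_etale_measurable compact T sets_eq_borel) measurable
  then have "(\<lambda>x. enn2real (ennreal (ruelle_op T \<psi> f x))) \<in> borel_measurable \<mu>"
    using assms by (simp add: fsum_eq_ruelle_op finite_fibre cong: measurable_cong)
  then show ?thesis
    using assms by (simp add: ruelle_op_nonneg)
qed

lemma continuous_bounded: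
  assumes "continuous_on UNIV (f :: 'a \<Rightarrow> real)"
  shows "\<exists>C. \<forall>x. \<bar>f x\<bar> \<le> C"
  using compact_imp_bounded[OF compact_continuous_image[OF assms compact]]
  unfolding bounded_iff by auto

lemma integrable_if_continuous:
  assumes "continuous_on UNIV (f :: 'a \<Rightarrow> real)"
  shows "integrable \<mu> f"
proof -
  obtain C where "\<forall>x. \<bar>f x\<bar> \<le> C" using continuous_bounded[OF assms] by blast
  moreover have "f \<in> borel_measurable \<mu>"
    using borel_measurable_continuous_onI[OF assms] sets_eq_borel by (simp cong: measurable_cong_sets)
  ultimately show ?thesis
    by (intro integrable_const_bound[of _ C]) auto
qed

text \<open>On a probability space boundedness and measurability suffice, so continuity of the image
  function is not established. The bound is the largest fibre size times the supremum of the
  weighted function.\<close>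

lemma integrable_ruelle_op:
  assumes f: "continuous_on UNIV f" "\<And>y. 0 \<le> f y"
  shows "integrable \<mu> (ruelle_op T \<psi> f)"
proof -
  have "continuous_on UNIV (\<lambda>y. exp (\<psi> y) * f y)"
    by (intro continuous_intros \<psi> f)
  then obtain C where C: "\<forall>y. \<bar>exp (\<psi> y) * f y\<bar> \<le> C" using continuous_bounded by blast
  obtain N where N: "\<And>x. card (T -` {x}) \<le> N" using etale_card_fibre[OF compact T] by blast
  have "0 \<le> C" using C[THEN spec, of undefined] by linarith
  have "\<bar>ruelle_op T \<psi> f x\<bar> \<le> real N * C" for x
  proof -
    have "\<bar>ruelle_op T \<psi> f x\<bar> \<le> (\<Sum>y\<in>{y. T y = x}. \<bar>exp (\<psi> y) * f y\<bar>)"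
      unfolding ruelle_op_def by (rule sum_abs)
    also have "\<dots> \<le> (\<Sum>y\<in>{y. T y = x}. C)"
      using C by (intro sum_mono) auto
    also have "\<dots> \<le> real N * C"
      using N[of x] \<open>0 \<le> C\<close> by (simp add: vimage_def mult_right_mono)
    finally show ?thesis .
  qed
  moreover have "ruelle_op T \<psi> f \<in> borel_measurable \<mu>"
    using f by (intro ruelle_op_measurable borel_measurable_continuous_onI)
  ultimately show ?thesis
    by (intro integrable_const_bound[of _ "real N * C"]) auto
qed

lemma dual_eigen_imp_continuous:
  assumes dual: "dual_eigen T \<psi> \<mu> 1" and f: "continuous_on UNIV f" "\<And>y. 0 \<le> f y"
  shows "(\<integral>\<^sup>+x. fsum T (\<lambda>y. ennreal (exp (\<psi> y)) * ennreal (f y)) x \<partial>\<mu>) = (\<integral>\<^sup>+x. ennreal (f x) \<partial>\<mu>)"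
proof -
  have "(\<integral>x. ruelle_op T \<psi> f x \<partial>\<mu>) = (\<integral>x. f x \<partial>\<mu>)"
    using dual f unfolding dual_eigen_def by simp
  then show ?thesis
    using f by (simp add: fsum_eq_ruelle_op finite_fibre nn_integral_eq_integral
        integrable_ruelle_op integrable_if_continuous ruelle_op_nonneg)
qed

text \<open>The functions \<open>min 1 (n * infdist x (- U))\<close> increase to the indicator of \<open>U\<close>; for
  \<open>U = UNIV\<close> this fails, because \<open>infdist\<close> from the empty set is \<open>0\<close>.\<close>
lemma dual_eigen_imp_open:
  assumes dual: "dual_eigen T \<psi> \<mu> 1" and U: "open U"
  shows "(\<integral>\<^sup>+x. fsum T (\<lambda>y. ennreal (exp (\<psi> y)) * indicator U y) x \<partial>\<mu>) = (\<integral>\<^sup>+x. indicator U x \<partial>\<mu>)"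
proof (cases "U = UNIV")
  case True
  then show ?thesis
    using dual_eigen_imp_continuous[OF dual, of "\<lambda>_. 1"] by simp
next
  case False
  define g where "g n x = min 1 (real n * infdist x (- U))" for n x
  have cont: "continuous_on UNIV (g n)" for n
    unfolding g_def by (intro continuous_intros)
  have g0: "0 \<le> g n x" for n x
    unfolding g_def by (simp add: infdist_nonneg)
  have inc: "incseq (\<lambda>n x. ennreal (g n x))"
    unfolding g_def incseq_def le_fun_def
    by (intro allI impI ennreal_leI min.mono mult_right_mono) (simp_all add: infdist_nonneg)
  have SUP: "(SUP n. ennreal (g n x)) = indicator U x" for x
  proof (cases "x \<in> U")
    case True
    \<comment> \<open>\<open>False\<close> is the outer assumption that \<open>U\<close> is not the
      whole space: the closed set \<open>- U\<close> is nonempty, so \<open>infdist\<close> vanishes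
      only on it.\<close>
    then have "infdist x (- U) > 0"
      using U False in_closed_iff_infdist_zero[of "- U" x] infdist_nonneg[of x "- U"] by force
    then obtain n where "1 \<le> real n * infdist x (- U)"
      by (metis ex_less_of_nat_mult less_imp_le)
    then have "ennreal (g n x) = 1" by (simp add: g_def)
    moreover have "ennreal (g m x) \<le> 1" for m by (simp add: g_def)
    ultimately have "(SUP n. ennreal (g n x)) = 1"
      by (intro antisym SUP_least) (auto intro: SUP_upper2[of n])
    then show ?thesis using True by simp
  next
    case False
    then have "infdist x (- U) = 0" by (intro infdist_zero) auto
    then show ?thesis using False by (simp add: g_def)
  qed
  let ?w = "\<lambda>y. ennreal (exp (\<psi> y))"
  have inc_w: "incseq (\<lambda>n y. ?w y * ennreal (g n y))"
    using inc by (auto simp: incseq_def le_fun_def intro!: mult_left_mono)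
  have [measurable]: "(\<lambda>x. ennreal (g n x)) \<in> borel_measurable borel" for n
    using borel_measurable_continuous_onI[OF cont[of n]] by measurable
  have meas: "fsum T (\<lambda>y. ?w y * ennreal (g n y)) \<in> borel_measurable \<mu>" for n
    by (intro fsum_etale_measurable compact T sets_eq_borel) measurable
  have "fsum T (\<lambda>y. ?w y * indicator U y) x = (SUP n. fsum T (\<lambda>y. ?w y * ennreal (g n y)) x)" for x
    by (simp add: fsum_SUP[OF inc_w, symmetric] SUP_mult_left_ennreal[symmetric] SUP)
  then have "(\<integral>\<^sup>+x. fsum T (\<lambda>y. ?w y * indicator U y) x \<partial>\<mu>) =
      (\<integral>\<^sup>+x. (SUP n. fsum T (\<lambda>y. ?w y * ennreal (g n y)) x) \<partial>\<mu>)"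
    by simp
  also have "\<dots> = (SUP n. \<integral>\<^sup>+x. fsum T (\<lambda>y. ?w y * ennreal (g n y)) x \<partial>\<mu>)"
    using inc_w meas
    by (intro nn_integral_monotone_convergence_SUP) (auto simp: incseq_def le_fun_def intro!: fsum_mono)
  also have "\<dots> = (SUP n. \<integral>\<^sup>+x. ennreal (g n x) \<partial>\<mu>)"
    using dual_eigen_imp_continuous[OF dual cont g0] by simp
  also have "\<dots> = (\<integral>\<^sup>+x. (SUP n. ennreal (g n x)) \<partial>\<mu>)"
    using inc sets_eq_borel
    by (intro nn_integral_monotone_convergence_SUP[symmetric]) (simp_all cong: measurable_cong_sets)
  finally show ?thesis
    by (simp add: SUP)
qed

text \<open>The weighted transfer integrates \<open>f\<close> against \<open>density ?P ?w\<close>.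
  This measure agrees with \<mu> on the open sets, an intersection-stable generator, hence equals
  \<mu>, which settles all Borel \<open>f\<close> at once.\<close>

lemma dual_eigen_imp_transfer_invariant:
  assumes dual: "dual_eigen T \<psi> \<mu> 1"
  shows "transfer_invariant \<mu> T (\<lambda>y. ennreal (exp (\<psi> y)))"
proof -
  let ?w = "\<lambda>y. ennreal (exp (\<psi> y))"
  let ?P = "pullback_measure borel T \<mu>"
  note cs = countable_sections_etale[OF compact T sets_eq_borel]
  have w: "?w \<in> borel_measurable ?P"
    using weight_measurable by (simp cong: measurable_cong_sets)
  have int: "(\<integral>\<^sup>+y. f y \<partial>density ?P ?w) = (\<integral>\<^sup>+x. fsum T (\<lambda>y. ?w y * f y) x \<partial>\<mu>)"
    if [measurable]: "f \<in> borel_measurable borel" for f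
  proof -
    have "f \<in> borel_measurable ?P"
      using that by (simp cong: measurable_cong_sets)
    then show ?thesis
      using w by (simp add: nn_integral_density nn_integral_pullback_measure[OF cs])
  qed
  have "density ?P ?w = \<mu>"
  proof (rule measure_eqI_generator_eq[where E = "{S. open S}" and \<Omega> = UNIV and A = "\<lambda>_. UNIV"])
    show "Int_stable {S :: 'a set. open S}"
      by (auto simp: Int_stable_def)
    show "sets (density ?P ?w) = sigma_sets UNIV {S. open S}" "sets \<mu> = sigma_sets UNIV {S. open S}"
      by (simp_all add: sets_eq_borel sets_borel_sigma_sets)
    show eq: "emeasure (density ?P ?w) U = emeasure \<mu> U" if "U \<in> {S. open S}" for U
    proof -
      have "emeasure (density ?P ?w) U = (\<integral>\<^sup>+y. indicator U y \<partial>density ?P ?w)"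
        using that by simp
      also have "\<dots> = (\<integral>\<^sup>+x. indicator U x \<partial>\<mu>)"
        using that int[of "indicator U"] dual_eigen_imp_open[OF dual, of U] by simp
      finally show ?thesis using that sets_eq_borel by simp
    qed
    have "emeasure \<mu> UNIV \<noteq> \<infinity>" by simp
    then show "emeasure (density ?P ?w) UNIV \<noteq> \<infinity>"
      using eq[of UNIV] by simp
  qed auto
  then show ?thesis
    using int unfolding transfer_invariant_def by simp
qed

text \<open>Split \<open>f\<close> into positive and negative parts; for these all integrals are
  finite, so the identities in \<open>ennreal\<close> become real ones and may be
  subtracted.\<close>

lemma transfer_invariant_imp_dual_eigen:
  assumes inv: "transfer_invariant \<mu> T (\<lambda>y. ennreal (exp (\<psi> y)))"
  shows "dual_eigen T \<psi> \<mu> 1"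
  unfolding dual_eigen_def
proof (intro allI impI)
  fix f :: "'a \<Rightarrow> real" assume f: "continuous_on UNIV f"
  have pos: "(\<integral>x. ruelle_op T \<psi> g x \<partial>\<mu>) = (\<integral>x. g x \<partial>\<mu>)"
    if g: "continuous_on UNIV g" "\<And>y. 0 \<le> g y" for g
  proof -
    have "(\<lambda>y. ennreal (g y)) \<in> borel_measurable borel"
      using borel_measurable_continuous_onI[OF g(1)] by measurable
    then have "(\<integral>\<^sup>+x. ennreal (ruelle_op T \<psi> g x) \<partial>\<mu>) = (\<integral>\<^sup>+x. ennreal (g x) \<partial>\<mu>)"
      using inv g unfolding transfer_invariant_def by (simp add: fsum_eq_ruelle_op[symmetric] finite_fibre)
    then show ?thesis
      using g by (simp add: nn_integral_eq_integral integrable_ruelle_op integrable_if_continuous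
          ruelle_op_nonneg)
  qed
  let ?p = "\<lambda>x. max (f x) 0" and ?m = "\<lambda>x. max (- f x) 0"
  have cont: "continuous_on UNIV ?p" "continuous_on UNIV ?m"
    by (intro continuous_intros f)+
  have "f x = ?p x - ?m x" for x by auto
  then have "ruelle_op T \<psi> f x = ruelle_op T \<psi> (\<lambda>x. ?p x - ?m x) x" for x by metis
  also have "\<dots> x = ruelle_op T \<psi> ?p x - ruelle_op T \<psi> ?m x" for x
    unfolding ruelle_op_def by (simp add: right_diff_distrib sum_subtractf)
  finally have "(\<integral>x. ruelle_op T \<psi> f x \<partial>\<mu>) = (\<integral>x. ?p x \<partial>\<mu>) - (\<integral>x. ?m x \<partial>\<mu>)"
    using pos[OF cont(1)] pos[OF cont(2)] integrable_ruelle_op[OF cont(1)] integrable_ruelle_op[OF cont(2)]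
    by (simp add: Bochner_Integration.integral_diff)
  also have "\<dots> = (\<integral>x. ?p x - ?m x \<partial>\<mu>)"
    using integrable_if_continuous[OF cont(1)] integrable_if_continuous[OF cont(2)]
    by (simp add: Bochner_Integration.integral_diff)
  also have "(\<lambda>x. ?p x - ?m x) = f" by auto
  finally show "(\<integral>x. ruelle_op T \<psi> f x \<partial>\<mu>) = 1 * (\<integral>x. f x \<partial>\<mu>)" by simp
qed

end

subsection \<open>The Borel structure of the groupoid\<close>

text \<open>The sets of \<open>basic_opens\<close> freed from injectivity and from the condition of
  equal images, so that \<open>U\<close> and \<open>V\<close> can be shrunk independently or taken
  to be the whole space.\<close>

definition rel_arrows :: "nat \<Rightarrow> (nat \<Rightarrow> 'a \<Rightarrow> 'a) \<Rightarrow> (nat \<Rightarrow> nat) \<Rightarrow> (nat \<Rightarrow> nat) \<Rightarrow> 'a set \<Rightarrow> 'a set \<Rightarrow> 'a garrow set"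
  where "rel_arrows k \<sigma> p q U V =
    {(x, idx_diff p q, y) | x y. x \<in> U \<and> y \<in> V \<and> siter \<sigma> k p x = siter \<sigma> k q y}"

definition garrow_algebra :: "nat \<Rightarrow> (nat \<Rightarrow> 'a::topological_space \<Rightarrow> 'a) \<Rightarrow> 'a garrow measure" where
  "garrow_algebra k \<sigma> = sigma (groupoid k \<sigma>) {B. openin (groupoid_top k \<sigma>) B}"

section \<open>Iterates indexed by multi-indices\<close>

lemma siter_zero [simp]: "siter \<sigma> k (\<lambda>_. 0) = id"
  by (induction k) auto

lemma siter_cong: "(\<And>i. i < k \<Longrightarrow> p i = q i) \<Longrightarrow> siter \<sigma> k p = siter \<sigma> k q"
  by (induction k) auto

lemma siter_unit:
  assumes "i < k"
  shows "siter \<sigma> k (\<lambda>j. if j = i then 1 else 0) = \<sigma> i"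
  using assms
proof (induction k)
  case (Suc k)
  show ?case
  proof (cases "i = k")
    case True
    have "siter \<sigma> k (\<lambda>j. if j = i then 1 else 0) = siter \<sigma> k (\<lambda>_. 0)"
      using True by (intro siter_cong) auto
    then show ?thesis using True by simp
  next
    case False
    then show ?thesis using Suc by simp
  qed
qed simp

lemma siter_commute:
  assumes "\<And>i. i < k \<Longrightarrow> f \<circ> \<sigma> i = \<sigma> i \<circ> f"
  shows "f \<circ> siter \<sigma> k p = siter \<sigma> k p \<circ> f"
  using assms
proof (induction k)
  case (Suc k)
  have "f (\<sigma> k x) = \<sigma> k (f x)" for x
    using Suc.prems[of k] by (simp add: fun_eq_iff)
  then have pow: "f \<circ> (\<sigma> k ^^ n) = (\<sigma> k ^^ n) \<circ> f" for n
    by (induction n) (simp_all add: fun_eq_iff)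
  have "f \<circ> siter \<sigma> k p = siter \<sigma> k p \<circ> f"
    by (rule Suc.IH) (rule Suc.prems, simp)
  with pow[of "p k"] show ?case
    by (simp add: fun_eq_iff)
qed simp

text \<open>Commutativity enters here: the power of \<sigma> \<open>k\<close> belonging to
  \<open>p\<close> has to move past the iterate of lower generators belonging to
  \<open>q\<close>.\<close>

lemma siter_add:
  assumes "\<And>i j. i < k \<Longrightarrow> j < k \<Longrightarrow> \<sigma> i \<circ> \<sigma> j = \<sigma> j \<circ> \<sigma> i"
  shows "siter \<sigma> k (\<lambda>i. p i + q i) = siter \<sigma> k p \<circ> siter \<sigma> k q"
  using assms
proof (induction k)
  case (Suc k)
  have pow: "(\<sigma> k ^^ n) \<circ> \<sigma> i = \<sigma> i \<circ> (\<sigma> k ^^ n)" if "i < k" for n i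
  proof -
    have "\<sigma> k (\<sigma> i x) = \<sigma> i (\<sigma> k x)" for x
      using Suc.prems[of i k] that by (simp add: fun_eq_iff)
    then show ?thesis
      by (induction n) (simp_all add: fun_eq_iff)
  qed
  have comm: "(\<sigma> k ^^ p k) \<circ> siter \<sigma> k q = siter \<sigma> k q \<circ> (\<sigma> k ^^ p k)"
    by (intro siter_commute pow)
  have IH: "siter \<sigma> k (\<lambda>i. p i + q i) = siter \<sigma> k p \<circ> siter \<sigma> k q"
    by (rule Suc.IH) (rule Suc.prems, simp_all)
  show ?case
    using comm by (simp add: IH funpow_add fun_eq_iff)
qed simp

lemma etale_siter:
  assumes "\<And>i. i < k \<Longrightarrow> etale (\<sigma> i)"
  shows "etale (siter \<sigma> k p)"
  using assms
proof (induction k)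
  case 0
  then show ?case using etale_id by (simp add: id_def)
next
  case (Suc k)
  have "etale (\<sigma> k)" by (rule Suc.prems) simp
  then have "etale (\<sigma> k ^^ n)" for n
  proof (induction n)
    case 0
    then show ?case using etale_id by (simp add: id_def)
  next
    case (Suc n)
    then show ?case using etale_comp[of "\<sigma> k" "\<sigma> k ^^ n"] by (simp add: comp_def)
  qed
  moreover have "etale (siter \<sigma> k p)"
    by (rule Suc.IH) (rule Suc.prems, simp)
  ultimately show ?case
    using etale_comp[of "siter \<sigma> k p" "\<sigma> k ^^ p k"] by (simp add: comp_def)
qed

lemma countable_multi_idx: "countable (multi_idx k)"
proof (rule countable_image_inj_on)
  show "countable ((\<lambda>p. map p [0..<k]) ` multi_idx k)" by simp
  show "inj_on (\<lambda>p. map p [0..<k]) (multi_idx k)"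
  proof (rule inj_onI)
    fix p q assume pq: "p \<in> multi_idx k" "q \<in> multi_idx k" "map p [0..<k] = map q [0..<k]"
    show "p = q"
    proof
      fix i
      show "p i = q i"
        using pq by (cases "i < k") (auto simp: multi_idx_def map_eq_conv)
    qed
  qed
qed

lemma zero_in_multi_idx [simp]: "(\<lambda>_. 0) \<in> multi_idx k"
  by (simp add: multi_idx_def)

lemma unit_in_multi_idx [simp]: "i < k \<Longrightarrow> (\<lambda>j. if j = i then 1 else 0) \<in> multi_idx k"
  by (simp add: multi_idx_def)

lemma add_in_multi_idx [simp]: "p \<in> multi_idx k \<Longrightarrow> q \<in> multi_idx k \<Longrightarrow> (\<lambda>i. p i + q i) \<in> multi_idx k"
  by (simp add: multi_idx_def)

text \<open>Induction on the total degree: lowering any nonzero entry by one reaches a smaller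
  multi-index.\<close>

lemma multi_idx_induct [consumes 1, case_names zero unit]:
  assumes "p \<in> multi_idx k" and zero: "P (\<lambda>_. 0)"
    and step: "\<And>p i. p \<in> multi_idx k \<Longrightarrow> i < k \<Longrightarrow> P p \<Longrightarrow> P (\<lambda>j. p j + (if j = i then 1 else 0))"
  shows "P p"
  using assms(1)
proof (induction "\<Sum>i<k. p i" arbitrary: p)
  case 0
  then have "p = (\<lambda>_. 0)"
    by (auto simp: multi_idx_def fun_eq_iff not_less[symmetric])
  then show ?case using zero by simp
next
  case (Suc n)
  then obtain i where i: "i < k" "p i \<noteq> 0"
    by (metis lessThan_iff nat.distinct(1) sum.neutral)
  define q where "q = p(i := p i - 1)"
  have p: "p = (\<lambda>j. q j + (if j = i then 1 else 0))"
    using i by (auto simp: q_def)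
  have "(\<Sum>j<k. p j) = (\<Sum>j<k. q j) + 1"
    using i by (subst p) (simp add: sum.distrib)
  then have "n = (\<Sum>i<k. q i)" using Suc by simp
  moreover have "q \<in> multi_idx k"
    using Suc i by (auto simp: q_def multi_idx_def)
  ultimately have "P q" using Suc by blast
  then show ?case
    using step[of q i] \<open>q \<in> multi_idx k\<close> i p by simp
qed

lemma g_rng_rel_arrows: "g_rng ` rel_arrows k \<sigma> p q U V = U \<inter> {x. siter \<sigma> k p x \<in> siter \<sigma> k q ` V}"
  by (auto simp: rel_arrows_def g_rng_def image_iff)

lemma inj_on_g_rng: "inj_on (siter \<sigma> k q) V \<Longrightarrow> inj_on g_rng (rel_arrows k \<sigma> p q U V)"
  by (auto simp: rel_arrows_def g_rng_def inj_on_def)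

lemma inj_on_g_src: "inj_on (siter \<sigma> k p) U \<Longrightarrow> inj_on g_src (rel_arrows k \<sigma> p q U V)"
  by (auto simp: rel_arrows_def g_src_def inj_on_def)

lemma g_rng_vimage_rel_arrows:
  "g_rng -` S \<inter> rel_arrows k \<sigma> p q U V = rel_arrows k \<sigma> p q (U \<inter> S) V"
  by (auto simp: rel_arrows_def g_rng_def)

lemma groupoid_eq_rel_arrows:
  "groupoid k \<sigma> = (\<Union>p\<in>multi_idx k. \<Union>q\<in>multi_idx k. rel_arrows k \<sigma> p q UNIV UNIV)"
  unfolding groupoid_def rel_arrows_def by blast

lemma basic_opens_eq: "basic_opens k \<sigma> = {rel_arrows k \<sigma> p q U V | U V p q.
    open U \<and> open V \<and> p \<in> multi_idx k \<and> q \<in> multi_idx k \<and>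
    inj_on (siter \<sigma> k p) U \<and> inj_on (siter \<sigma> k q) V \<and> siter \<sigma> k p ` U = siter \<sigma> k q ` V}"
  unfolding basic_opens_def rel_arrows_def ..

section \<open>Topology of the groupoid\<close>

locale etale_action =
  fixes k :: nat and \<sigma> :: "nat \<Rightarrow> 'a::metric_space \<Rightarrow> 'a"
  assumes compact: "compact (UNIV :: 'a set)"
    and etale: "\<And>i. i < k \<Longrightarrow> etale (\<sigma> i)"
    and commute: "\<And>i j. i < k \<Longrightarrow> j < k \<Longrightarrow> \<sigma> i \<circ> \<sigma> j = \<sigma> j \<circ> \<sigma> i"
begin

lemma etale_s: "etale (siter \<sigma> k p)"
  by (intro etale_siter etale)

lemma continuous_s: "continuous_on UNIV (siter \<sigma> k p)"
  using etale_s[of p] by (simp add: etale_def)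

lemma open_vimage_s: "open U \<Longrightarrow> open (siter \<sigma> k p -` U)"
  using continuous_s by (intro open_vimage) auto

lemma open_image_s: "open U \<Longrightarrow> open (siter \<sigma> k p ` U)"
  using etale_s[of p] by (simp add: etale_def)

lemma locally_inj_s: "\<exists>U. open U \<and> x \<in> U \<and> inj_on (siter \<sigma> k p) U"
  using etale_s[of p] by (simp add: etale_def)

text \<open>A degree in \<open>\<int>\<^sup>k\<close> has many representations \<open>p - q\<close>. Both representations lift to a common
  one, and the powers of \<open>\<sigma>\<close> used for lifting are locally injective.\<close>
lemma relation_locally_independent:
  assumes diff: "idx_diff p q = idx_diff p' q'"
    and eq': "siter \<sigma> k p' x = siter \<sigma> k q' y"
  shows "\<exists>U V. open U \<and> open V \<and> x \<in> U \<and> y \<in> V \<and>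
    (\<forall>x'\<in>U. \<forall>y'\<in>V. siter \<sigma> k p x' = siter \<sigma> k q y' \<longrightarrow> siter \<sigma> k p' x' = siter \<sigma> k q' y')"
proof -
  \<comment> \<open>Truncated subtraction makes \<open>a i + p i\<close> and
    \<open>b i + p' i\<close> both equal to the maximum of \<open>p i\<close> and
    \<open>p' i\<close>. Applying the iterate for \<open>a\<close> lifts the relation; local
    injectivity of the iterate for \<open>b\<close> brings it down to the other
    representation.\<close>
  define a b where "a i = p' i - p i" and "b i = p i - p' i" for i
  have "int (p i) - int (q i) = int (p' i) - int (q' i)" for i
    using diff by (simp add: idx_diff_def fun_eq_iff)
  then have q: "(\<lambda>i. a i + q i) = (\<lambda>i. b i + q' i)"
    unfolding a_def b_def by (intro ext) (smt (verit) of_nat_add of_nat_diff of_nat_eq_iff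
        diff_is_0_eq' add_0 nat_le_linear)
  have p: "(\<lambda>i. a i + p i) = (\<lambda>i. b i + p' i)"
    unfolding a_def b_def by auto
  obtain W where W: "open W" "siter \<sigma> k p' x \<in> W" "inj_on (siter \<sigma> k b) W"
    using locally_inj_s by blast
  have "siter \<sigma> k p' x' = siter \<sigma> k q' y'"
    if "x' \<in> siter \<sigma> k p' -` W" "y' \<in> siter \<sigma> k q' -` W" "siter \<sigma> k p x' = siter \<sigma> k q y'" for x' y'
  proof -
    have "siter \<sigma> k (\<lambda>i. a i + p i) x' = siter \<sigma> k (\<lambda>i. a i + q i) y'"
      using that siter_add[OF commute] by simp
    then have "siter \<sigma> k b (siter \<sigma> k p' x') = siter \<sigma> k b (siter \<sigma> k q' y')"
      unfolding p q using siter_add[OF commute] by simp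
    then show ?thesis using W that by (auto dest: inj_onD)
  qed
  then show ?thesis
    using W eq' open_vimage_s by (intro exI[of _ "siter \<sigma> k p' -` W"] exI[of _ "siter \<sigma> k q' -` W"]) auto
qed

text \<open>A basic set containing the arrow may represent its degree by another pair than
  \<open>p\<close>, \<open>q\<close>; local independence of the representation lets the given pair
  be kept.\<close>

lemma openin_groupoid_nbhd:
  assumes "openin (groupoid_top k \<sigma>) S" "(x, idx_diff p q, y) \<in> S" "siter \<sigma> k p x = siter \<sigma> k q y"
  shows "\<exists>U V. open U \<and> open V \<and> x \<in> U \<and> y \<in> V \<and> rel_arrows k \<sigma> p q U V \<subseteq> S"
proof -
  have "generate_topology_on (basic_opens k \<sigma>) S"
    using assms(1) unfolding groupoid_top_def openin_topology_generated_by_iff .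
  then show ?thesis using assms(2)
  proof induction
    case Empty
    then show ?case by simp
  next
    case (Int a b)
    then obtain U V U' V' where
      "open U" "open V" "x \<in> U" "y \<in> V" "rel_arrows k \<sigma> p q U V \<subseteq> a"
      "open U'" "open V'" "x \<in> U'" "y \<in> V'" "rel_arrows k \<sigma> p q U' V' \<subseteq> b"
      by auto
    then show ?case
      by (intro exI[of _ "U \<inter> U'"] exI[of _ "V \<inter> V'"]) (auto simp: rel_arrows_def)
  next
    case (UN K)
    then show ?case by (meson Union_iff Union_upper order_trans)
  next
    case (Basis s)
    then obtain U V p' q' where s: "s = rel_arrows k \<sigma> p' q' U V" "open U" "open V"
      unfolding basic_opens_eq by blast
    with Basis have xy: "x \<in> U" "y \<in> V" "idx_diff p q = idx_diff p' q'"
      "siter \<sigma> k p' x = siter \<sigma> k q' y"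
      by (auto simp: rel_arrows_def)
    obtain U' V' where U': "open U'" "open V'" "x \<in> U'" "y \<in> V'"
      "\<forall>x'\<in>U'. \<forall>y'\<in>V'. siter \<sigma> k p x' = siter \<sigma> k q y' \<longrightarrow> siter \<sigma> k p' x' = siter \<sigma> k q' y'"
      using relation_locally_independent[OF xy(3,4)] by blast
    then have "rel_arrows k \<sigma> p q (U \<inter> U') (V \<inter> V') \<subseteq> s"
      using xy(3) by (auto simp: s rel_arrows_def)
    then show ?case
      using s xy U' by (intro exI[of _ "U \<inter> U'"] exI[of _ "V \<inter> V'"]) auto
  qed
qed

lemma bisection_nbhd:
  assumes "open U" "open V" "x \<in> U" "y \<in> V" "siter \<sigma> k p x = siter \<sigma> k q y"
  shows "\<exists>U' V'. open U' \<and> open V' \<and> x \<in> U' \<and> y \<in> V' \<and> U' \<subseteq> U \<and> V' \<subseteq> V \<and>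
    inj_on (siter \<sigma> k p) U' \<and> inj_on (siter \<sigma> k q) V' \<and> siter \<sigma> k p ` U' = siter \<sigma> k q ` V'"
proof -
  obtain A where A: "open A" "x \<in> A" "inj_on (siter \<sigma> k p) A" using locally_inj_s by blast
  obtain B where B: "open B" "y \<in> B" "inj_on (siter \<sigma> k q) B" using locally_inj_s by blast
  \<comment> \<open>\<open>W\<close> is the common image: pulling it back along both locally
    injective iterates forces the two images to coincide.\<close>
  define W where "W = siter \<sigma> k p ` (U \<inter> A) \<inter> siter \<sigma> k q ` (V \<inter> B)"
  have W: "open W"
    unfolding W_def using assms A B by (intro open_Int open_image_s)
  have "siter \<sigma> k p x \<in> W"
    unfolding W_def using assms A B by blast
  moreover have "f ` (S \<inter> f -` W) = W" if "W \<subseteq> f ` S" for f :: "'a \<Rightarrow> 'a" and S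
    using that by auto
  then have "siter \<sigma> k p ` (U \<inter> A \<inter> siter \<sigma> k p -` W) = W"
    "siter \<sigma> k q ` (V \<inter> B \<inter> siter \<sigma> k q -` W) = W"
    by (simp_all add: W_def)
  ultimately show ?thesis
    using assms A B W open_vimage_s
    by (intro exI[of _ "U \<inter> A \<inter> siter \<sigma> k p -` W"] exI[of _ "V \<inter> B \<inter> siter \<sigma> k q -` W"])
      (auto intro: inj_on_subset)
qed

text \<open>Around every arrow there is a smaller set that does satisfy the conditions of
  \<open>basic_opens\<close>.\<close>

lemma openin_rel_arrows:
  assumes "open U" "open V" and pq: "p \<in> multi_idx k" "q \<in> multi_idx k"
  shows "openin (groupoid_top k \<sigma>) (rel_arrows k \<sigma> p q U V)"
proof (subst openin_subopen, intro ballI)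
  fix \<gamma> assume "\<gamma> \<in> rel_arrows k \<sigma> p q U V"
  then obtain x y where \<gamma>: "\<gamma> = (x, idx_diff p q, y)" "x \<in> U" "y \<in> V" "siter \<sigma> k p x = siter \<sigma> k q y"
    by (auto simp: rel_arrows_def)
  obtain U' V' where UV: "open U'" "open V'" "x \<in> U'" "y \<in> V'" "U' \<subseteq> U" "V' \<subseteq> V"
    "inj_on (siter \<sigma> k p) U'" "inj_on (siter \<sigma> k q) V'" "siter \<sigma> k p ` U' = siter \<sigma> k q ` V'"
    using bisection_nbhd[OF assms(1,2) \<gamma>(2-4)] by blast
  have "rel_arrows k \<sigma> p q U' V' \<in> basic_opens k \<sigma>"
    unfolding basic_opens_eq using UV pq by blast
  then have "openin (groupoid_top k \<sigma>) (rel_arrows k \<sigma> p q U' V')"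
    unfolding groupoid_top_def by (rule topology_generated_by_Basis)
  moreover have "\<gamma> \<in> rel_arrows k \<sigma> p q U' V'" "rel_arrows k \<sigma> p q U' V' \<subseteq> rel_arrows k \<sigma> p q U V"
    using \<gamma> UV by (auto simp: rel_arrows_def)
  ultimately show "\<exists>S. openin (groupoid_top k \<sigma>) S \<and> \<gamma> \<in> S \<and> S \<subseteq> rel_arrows k \<sigma> p q U V"
    by blast
qed

lemma topspace_groupoid: "topspace (groupoid_top k \<sigma>) = groupoid k \<sigma>"
proof
  show "topspace (groupoid_top k \<sigma>) \<subseteq> groupoid k \<sigma>"
    unfolding groupoid_top_def topology_generated_by_topspace basic_opens_eq groupoid_eq_rel_arrows
    by (fastforce simp: rel_arrows_def)
  show "groupoid k \<sigma> \<subseteq> topspace (groupoid_top k \<sigma>)"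
    unfolding groupoid_eq_rel_arrows
    by (intro UN_least openin_subset openin_rel_arrows) auto
qed

text \<open>Inside \<open>S\<close> there is a neighbourhood given by \<open>U'\<close> and
  \<open>V'\<close> with equal images, so each point of \<open>U'\<close> has a partner in
  \<open>V'\<close> and conversely: both projections cover full neighbourhoods.\<close>

lemma open_image_rng_src:
  assumes S: "openin (groupoid_top k \<sigma>) S"
  shows "open (g_rng ` S)" "open (g_src ` S)"
proof -
  have "\<exists>U' V'. open U' \<and> open V' \<and> g_rng \<gamma> \<in> U' \<and> g_src \<gamma> \<in> V' \<and> U' \<subseteq> g_rng ` S \<and> V' \<subseteq> g_src ` S"
    if "\<gamma> \<in> S" for \<gamma>
  proof -
    have "\<gamma> \<in> groupoid k \<sigma>"
      using that openin_subset[OF S] topspace_groupoid by blast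
    then obtain x p q y where \<gamma>: "\<gamma> = (x, idx_diff p q, y)" "siter \<sigma> k p x = siter \<sigma> k q y"
      unfolding groupoid_def by blast
    then have "(x, idx_diff p q, y) \<in> S" using that by simp
    from openin_groupoid_nbhd[OF S this \<gamma>(2)]
    obtain U V where UV: "open U" "open V" "x \<in> U" "y \<in> V" "rel_arrows k \<sigma> p q U V \<subseteq> S"
      by blast
    obtain U' V' where UV': "open U'" "open V'" "x \<in> U'" "y \<in> V'" "U' \<subseteq> U" "V' \<subseteq> V"
      "siter \<sigma> k p ` U' = siter \<sigma> k q ` V'"
      using bisection_nbhd[OF UV(1-4) \<gamma>(2)] by blast
    have "U' \<subseteq> g_rng ` S"
    proof
      fix x' assume x': "x' \<in> U'"
      then obtain y' where "y' \<in> V'" "siter \<sigma> k p x' = siter \<sigma> k q y'"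
        using UV'(7) by (metis imageE imageI)
      then have "(x', idx_diff p q, y') \<in> S"
        using x' UV(5) UV'(5,6) unfolding rel_arrows_def by blast
      then show "x' \<in> g_rng ` S"
        by (rule rev_image_eqI) (simp add: g_rng_def)
    qed
    moreover have "V' \<subseteq> g_src ` S"
    proof
      fix y' assume y': "y' \<in> V'"
      then obtain x' where "x' \<in> U'" "siter \<sigma> k p x' = siter \<sigma> k q y'"
        using UV'(7) by (metis imageE imageI)
      then have "(x', idx_diff p q, y') \<in> S"
        using y' UV(5) UV'(5,6) unfolding rel_arrows_def by blast
      then show "y' \<in> g_src ` S"
        by (rule rev_image_eqI) (simp add: g_src_def)
    qed
    ultimately show ?thesis
      using UV' \<gamma> by (intro exI[of _ U'] exI[of _ V']) (auto simp: g_rng_def g_src_def)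
  qed
  note nbhd = this
  show "open (g_rng ` S)"
  proof (subst open_subopen, intro ballI)
    fix x assume "x \<in> g_rng ` S"
    then obtain \<gamma> where "\<gamma> \<in> S" "x = g_rng \<gamma>" by blast
    with nbhd[of \<gamma>] show "\<exists>U. open U \<and> x \<in> U \<and> U \<subseteq> g_rng ` S" by auto
  qed
  show "open (g_src ` S)"
  proof (subst open_subopen, intro ballI)
    fix y assume "y \<in> g_src ` S"
    then obtain \<gamma> where "\<gamma> \<in> S" "y = g_src \<gamma>" by blast
    with nbhd[of \<gamma>] show "\<exists>U. open U \<and> y \<in> U \<and> U \<subseteq> g_src ` S" by auto
  qed
qed

section \<open>Borel sets of the groupoid and the measures pulled back to them\<close>

abbreviation "G \<equiv> garrow_algebra k \<sigma>"

lemma opens_subset: "{B. openin (groupoid_top k \<sigma>) B} \<subseteq> Pow (groupoid k \<sigma>)"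
  using openin_subset topspace_groupoid by blast

lemma space_G [simp]: "space G = groupoid k \<sigma>"
  unfolding garrow_algebra_def by (rule space_measure_of[OF opens_subset])

lemma sets_G: "sets G = sigma_sets (groupoid k \<sigma>) {B. openin (groupoid_top k \<sigma>) B}"
  unfolding garrow_algebra_def by (rule sets_measure_of[OF opens_subset])

lemma openin_in_sets_G: "openin (groupoid_top k \<sigma>) S \<Longrightarrow> S \<in> sets G"
  unfolding sets_G by (auto intro: sigma_sets.Basic)

lemma rng_measurable [measurable]: "g_rng \<in> G \<rightarrow>\<^sub>M borel"
proof (rule borel_measurableI)
  fix S :: "'a set" assume "open S"
  have "g_rng -` S \<inter> space G = (\<Union>p\<in>multi_idx k. \<Union>q\<in>multi_idx k. rel_arrows k \<sigma> p q S UNIV)"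
    unfolding space_G groupoid_eq_rel_arrows by (simp add: Int_UN_distrib g_rng_vimage_rel_arrows)
  also have "openin (groupoid_top k \<sigma>) \<dots>"
    using \<open>open S\<close> by (auto intro!: openin_Union openin_rel_arrows)
  finally show "g_rng -` S \<inter> space G \<in> sets G"
    by (rule openin_in_sets_G)
qed

lemma continuous_map_imp_measurable:
  assumes "continuous_map (groupoid_top k \<sigma>) euclideanreal c"
  shows "c \<in> borel_measurable G"
proof (rule borel_measurableI)
  fix S :: "real set" assume "open S"
  then have "openin (groupoid_top k \<sigma>) {\<gamma> \<in> topspace (groupoid_top k \<sigma>). c \<gamma> \<in> S}"
    using assms by (intro openin_continuous_map_preimage) auto
  moreover have "{\<gamma> \<in> topspace (groupoid_top k \<sigma>). c \<gamma> \<in> S} = c -` S \<inter> space G"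
    using topspace_groupoid by auto
  ultimately show "c -` S \<inter> space G \<in> sets G"
    using openin_in_sets_G by simp
qed

text \<open>Compactness gives, for each \<open>p\<close> and \<open>q\<close>, finite covers by sets on which \<open>\<sigma>\<^sup>p\<close> and \<open>\<sigma>\<^sup>q\<close> are
  injective; their pullbacks are bisections.\<close>
lemma countable_bisection_cover:
  "\<exists>\<W>. countable \<W> \<and> \<Union>\<W> = groupoid k \<sigma> \<and>
     (\<forall>W\<in>\<W>. openin (groupoid_top k \<sigma>) W \<and> inj_on g_rng W \<and> inj_on g_src W)"
proof -
  have "\<forall>p. \<exists>\<U>. finite \<U> \<and> \<Union>\<U> = UNIV \<and> (\<forall>U\<in>\<U>. open U \<and> inj_on (siter \<sigma> k p) U)"
    using etale_finite_cover[OF compact etale_s] by blast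
  then obtain \<U> where \<U>: "\<And>p. finite (\<U> p)" "\<And>p. \<Union>(\<U> p) = UNIV"
    "\<And>p U. U \<in> \<U> p \<Longrightarrow> open U \<and> inj_on (siter \<sigma> k p) U"
    by metis
  define \<W> where "\<W> = (\<Union>p\<in>multi_idx k. \<Union>q\<in>multi_idx k. \<Union>U\<in>\<U> p. (\<lambda>V. rel_arrows k \<sigma> p q U V) ` \<U> q)"
  have "countable \<W>"
    unfolding \<W>_def using \<U>(1)
    by (intro countable_UN countable_multi_idx countable_image countable_finite)
  moreover have "\<Union>\<W> = groupoid k \<sigma>"
  proof
    show "\<Union>\<W> \<subseteq> groupoid k \<sigma>"
      unfolding \<W>_def groupoid_eq_rel_arrows by (fastforce simp: rel_arrows_def)
    show "groupoid k \<sigma> \<subseteq> \<Union>\<W>"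
    proof
      fix \<gamma> assume "\<gamma> \<in> groupoid k \<sigma>"
      then obtain p q x y where \<gamma>: "p \<in> multi_idx k" "q \<in> multi_idx k"
        "\<gamma> = (x, idx_diff p q, y)" "siter \<sigma> k p x = siter \<sigma> k q y"
        by (auto simp: groupoid_def)
      moreover obtain U where "U \<in> \<U> p" "x \<in> U" using \<U>(2) by blast
      moreover obtain V where "V \<in> \<U> q" "y \<in> V" using \<U>(2) by blast
      ultimately have "\<gamma> \<in> rel_arrows k \<sigma> p q U V" "rel_arrows k \<sigma> p q U V \<in> \<W>"
        unfolding \<W>_def by (auto simp: rel_arrows_def)
      then show "\<gamma> \<in> \<Union>\<W>" by blast
    qed
  qed
  moreover have "openin (groupoid_top k \<sigma>) W \<and> inj_on g_rng W \<and> inj_on g_src W" if mem: "W \<in> \<W>" for W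
  proof -
    obtain p q U V where W: "p \<in> multi_idx k" "q \<in> multi_idx k" "U \<in> \<U> p" "V \<in> \<U> q"
      "W = rel_arrows k \<sigma> p q U V"
      using mem unfolding \<W>_def by blast
    then show ?thesis
      using \<U>(3)[OF W(3)] \<U>(3)[OF W(4)] by (simp add: openin_rel_arrows inj_on_g_rng inj_on_g_src)
  qed
  ultimately show ?thesis by blast
qed

text \<open>Range and source are open maps, so open subsets of a bisection have open images, and
  injectivity extends this to Borel images of Borel subsets.\<close>

lemma countable_sections_groupoid:
  assumes "sets \<mu> = sets borel"
  shows "countable_sections G \<mu> g_rng" "countable_sections G \<mu> g_src"
proof -
  obtain \<W> where \<W>: "countable \<W>" "\<Union>\<W> = groupoid k \<sigma>"
    "\<forall>W\<in>\<W>. openin (groupoid_top k \<sigma>) W \<and> inj_on g_rng W \<and> inj_on g_src W"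
    using countable_bisection_cover by blast
  have im: "r ` (B \<inter> W) \<in> sets \<mu>"
    if "W \<in> \<W>" "B \<in> sets G" "inj_on r W" "\<And>S. openin (groupoid_top k \<sigma>) S \<Longrightarrow> open (r ` S)"
    for r B W
    unfolding assms
  proof (rule inj_image_in_sets[OF that(3)])
    show "W \<subseteq> groupoid k \<sigma>" using that \<W> by blast
    show "r ` W \<in> sets borel" using that \<W> by (intro borel_open) blast
    show "r ` (A \<inter> W) \<in> sets borel" if "A \<in> {B. openin (groupoid_top k \<sigma>) B}" for A
      using that \<open>W \<in> \<W>\<close> \<W>
      by (intro borel_open \<open>\<And>S. openin (groupoid_top k \<sigma>) S \<Longrightarrow> open (r ` S)\<close> openin_Int) auto
    show "B \<in> sigma_sets (groupoid k \<sigma>) {B. openin (groupoid_top k \<sigma>) B}"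
      using that sets_G by simp
  qed
  show "countable_sections G \<mu> g_rng" "countable_sections G \<mu> g_src"
    unfolding countable_sections_def using \<W> im openin_in_sets_G open_image_rng_src
    by (intro exI[of _ \<W>]; simp)+
qed

text \<open>\<open>measure_of\<close> yields the zero measure unless the given set function is a
  measure on the generated sigma-algebra; countable additivity is supplied by the countable
  sections.\<close>

lemma measure_of_opens_eq_pullback:
  assumes cs: "countable_sections G \<mu> r"
  shows "measure_of (groupoid k \<sigma>) {B. openin (groupoid_top k \<sigma>) B}
     (\<lambda>B. \<integral>\<^sup>+ x. emeasure (count_space UNIV) {\<gamma> \<in> groupoid k \<sigma>. r \<gamma> = x \<and> \<gamma> \<in> B} \<partial>\<mu>) =
     pullback_measure G r \<mu>"
  (is "measure_of _ _ ?m = _")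
proof -
  have m: "?m B = (\<integral>\<^sup>+x. fsum r (indicator B) x \<partial>\<mu>)" if "B \<in> sets G" for B
  proof -
    have "B \<subseteq> groupoid k \<sigma>" using sets.sets_into_space[OF that] by simp
    then have "{\<gamma> \<in> groupoid k \<sigma>. r \<gamma> = x \<and> \<gamma> \<in> B} = B \<inter> r -` {x}" for x
      by auto
    then show ?thesis
      unfolding fsum_def by (simp add: indicator_inter_arith[symmetric])
  qed
  let ?L = "measure_of (groupoid k \<sigma>) {B. openin (groupoid_top k \<sigma>) B} ?m"
  have sets_L: "sets ?L = sets G"
    by (simp add: sets_G sets_measure_of[OF opens_subset])
  show ?thesis
  proof (rule measure_eqI)
    show "sets ?L = sets (pullback_measure G r \<mu>)"
      by (simp add: sets_L)
    fix B assume "B \<in> sets ?L"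
    then have B: "B \<in> sets G" by (simp add: sets_L)
    have "emeasure ?L B = ?m B"
    proof (rule emeasure_measure_of[OF refl opens_subset])
      show "positive (sets ?L) ?m"
        by (simp add: positive_def)
      show "countably_additive (sets ?L) ?m"
        unfolding sets_L
      proof (rule countably_additiveI)
        fix A :: "nat \<Rightarrow> _" assume A: "range A \<subseteq> sets G" "disjoint_family A" "(\<Union>i. A i) \<in> sets G"
        then have A_i: "A i \<in> sets G" for i by auto
        have "(\<Sum>i. \<integral>\<^sup>+x. fsum r (indicator (A i)) x \<partial>\<mu>) = (\<integral>\<^sup>+x. fsum r (indicator (\<Union>i. A i)) x \<partial>\<mu>)"
          using countably_additive_fsum[OF cs] A unfolding countably_additive_def by blast
        then show "(\<Sum>i. ?m (A i)) = ?m (\<Union>i. A i)"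
          by (simp only: m[OF A_i] m[OF A(3)])
      qed
      show "B \<in> sets ?L" by fact
    qed
    also have "\<dots> = emeasure (pullback_measure G r \<mu>) B"
      by (simp add: m B emeasure_pullback_measure[OF cs])
    finally show "emeasure ?L B = emeasure (pullback_measure G r \<mu>) B" .
  qed
qed

end

subsection \<open>The cocycle as a Radon-Nikodym derivative\<close>

locale cocycle_action = etale_action k \<sigma>
  for k :: nat and \<sigma> :: "nat \<Rightarrow> 'a::metric_space \<Rightarrow> 'a" +
  fixes \<phi> :: "nat \<Rightarrow> 'a \<Rightarrow> real" and c :: "'a garrow \<Rightarrow> real" and \<mu> :: "'a measure"
  assumes phi: "\<And>i. i < k \<Longrightarrow> continuous_on UNIV (\<phi> i)"
    and cocycle: "is_cocycle_c k \<sigma> \<phi> c"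
    and mu: "borel_prob \<mu>"
begin

lemma sets_mu: "sets \<mu> = sets borel"
  using mu by (simp add: borel_prob_def)

lemma measurable_mu: "f \<in> borel_measurable \<mu> \<Longrightarrow> f \<in> borel_measurable borel"
  using sets_mu by (simp cong: measurable_cong_sets)

lemmas cs_rng = countable_sections_groupoid(1)[OF sets_mu]
lemmas cs_src = countable_sections_groupoid(2)[OF sets_mu]

abbreviation "rng_measure \<equiv> pullback_measure G g_rng \<mu>"
abbreviation "src_measure \<equiv> pullback_measure G g_src \<mu>"

lemma rng_pull_eq: "rng_pull k \<sigma> \<mu> = rng_measure"
  unfolding rng_pull_def by (rule measure_of_opens_eq_pullback[OF cs_rng])

lemma src_pull_eq: "src_pull k \<sigma> \<mu> = src_measure"
  unfolding src_pull_def by (rule measure_of_opens_eq_pullback[OF cs_src])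

lemma c_measurable [measurable]: "c \<in> borel_measurable G"
  using cocycle by (intro continuous_map_imp_measurable) (simp add: is_cocycle_c_def)

lemma c_add:
  assumes "(x, m, y) \<in> groupoid k \<sigma>" "(y, n, z) \<in> groupoid k \<sigma>" "\<And>i. l i = m i + n i"
  shows "c (x, l, z) = c (x, m, y) + c (y, n, z)"
proof -
  have "l = (\<lambda>i. m i + n i)" using assms(3) by auto
  then show ?thesis
    using cocycle assms(1,2) unfolding is_cocycle_c_def by blast
qed

lemma arrow: "p \<in> multi_idx k \<Longrightarrow> q \<in> multi_idx k \<Longrightarrow> siter \<sigma> k p x = siter \<sigma> k q y \<Longrightarrow>
    (x, idx_diff p q, y) \<in> groupoid k \<sigma>"
  unfolding groupoid_def by blast

lemma forward_arrow: "p \<in> multi_idx k \<Longrightarrow> (x, idx_diff p (\<lambda>_. 0), siter \<sigma> k p x) \<in> groupoid k \<sigma>"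
  by (rule arrow) simp_all

lemma idx_diff_unit: "idx_diff (\<lambda>j. if j = i then 1 else 0) (\<lambda>_. 0) = unit_vec i"
  by (auto simp: idx_diff_def unit_vec_def)

text \<open>The Birkhoff sum of the potentials along the iterate for \<open>p\<close>, read off from
  the cocycle so that its independence of the order of the generators is built in.\<close>

definition weight :: "(nat \<Rightarrow> nat) \<Rightarrow> 'a \<Rightarrow> real" where
  "weight p x = c (x, idx_diff p (\<lambda>_. 0), siter \<sigma> k p x)"

text \<open>A unit arrow is its own square, so \<open>c\<close> vanishes on it.\<close>

lemma weight_zero: "weight (\<lambda>_. 0) x = 0"
proof -
  have "(x, idx_diff (\<lambda>_. 0) (\<lambda>_. 0), x) \<in> groupoid k \<sigma>" by (rule arrow) simp_all
  from c_add[OF this this, of "idx_diff (\<lambda>_. 0) (\<lambda>_. 0)"] show ?thesis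
    by (simp add: weight_def idx_diff_def)
qed

lemma weight_unit: "i < k \<Longrightarrow> weight (\<lambda>j. if j = i then 1 else 0) x = \<phi> i x"
  using cocycle by (simp add: weight_def idx_diff_unit siter_unit is_cocycle_c_def)

lemma weight_add:
  assumes "p \<in> multi_idx k" "q \<in> multi_idx k"
  shows "weight (\<lambda>i. p i + q i) x = weight q x + weight p (siter \<sigma> k q x)"
proof -
  have "siter \<sigma> k (\<lambda>i. p i + q i) x = siter \<sigma> k p (siter \<sigma> k q x)"
    using siter_add[OF commute, where p = p and q = q] by simp
  then show ?thesis
    unfolding weight_def
    by (simp only:) (rule c_add[OF forward_arrow forward_arrow], simp_all add: assms idx_diff_def)
qed

text \<open>The arrow from \<open>x\<close> of degree \<open>p\<close> factors through
  \<open>y\<close>: first degree p - q, then degree \<open>q\<close> to the common endpoint.\<close>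

lemma c_eq_weight_diff:
  assumes "p \<in> multi_idx k" "q \<in> multi_idx k" "siter \<sigma> k p x = siter \<sigma> k q y"
  shows "weight p x = c (x, idx_diff p q, y) + weight q y"
  unfolding weight_def assms(3)
  by (rule c_add[OF arrow forward_arrow]) (simp_all add: assms idx_diff_def)

text \<open>A unit step precomposes the iterate with one generator, and the cocycle law gives
  exactly the weight that \<open>transfer_invariant_comp\<close> produces.\<close>

lemma weight_invariant:
  assumes inv: "\<And>i. i < k \<Longrightarrow> transfer_invariant \<mu> (\<sigma> i) (\<lambda>y. ennreal (exp (\<phi> i y)))"
    and p: "p \<in> multi_idx k"
  shows "weight p \<in> borel_measurable borel \<and>
    transfer_invariant \<mu> (siter \<sigma> k p) (\<lambda>y. ennreal (exp (weight p y)))"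
  using p
proof (induction rule: multi_idx_induct)
  case zero
  have "weight (\<lambda>_. 0) = (\<lambda>_. 0)" by (simp add: fun_eq_iff weight_zero)
  then show ?case using transfer_invariant_id by (simp add: id_def)
next
  case (unit p i)
  let ?e = "\<lambda>j. if j = i then 1 else (0::nat)"
  have w: "weight (\<lambda>j. p j + ?e j) = (\<lambda>x. \<phi> i x + weight p (\<sigma> i x))"
    using unit weight_add[of p ?e] by (simp add: fun_eq_iff weight_unit siter_unit)
  have [measurable]: "\<phi> i \<in> borel_measurable borel" "\<sigma> i \<in> borel_measurable borel"
    "weight p \<in> borel_measurable borel"
    using unit phi etale[of i] by (auto intro: borel_measurable_continuous_onI simp: etale_def)
  have "transfer_invariant \<mu> (siter \<sigma> k p \<circ> \<sigma> i)
      (\<lambda>y. ennreal (exp (weight p (\<sigma> i y))) * ennreal (exp (\<phi> i y)))"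
    using unit inv etale compact by (intro transfer_invariant_comp) auto
  moreover have "ennreal (exp (weight p (\<sigma> i y))) * ennreal (exp (\<phi> i y)) =
      ennreal (exp (\<phi> i y + weight p (\<sigma> i y)))" for y
    by (simp add: ennreal_mult[symmetric] exp_add mult.commute)
  moreover have "siter \<sigma> k (\<lambda>j. p j + ?e j) = siter \<sigma> k p \<circ> \<sigma> i"
    using unit by (simp only: siter_add[OF commute] siter_unit)
  ultimately show ?case
    unfolding w by (simp add: comp_def)
qed

lemma emeasure_rng_eq_density:
  assumes inv: "\<And>i. i < k \<Longrightarrow> transfer_invariant \<mu> (\<sigma> i) (\<lambda>y. ennreal (exp (\<phi> i y)))"
    and p: "p \<in> multi_idx k" and q: "q \<in> multi_idx k"
    and B: "B \<in> sets G" "B \<subseteq> rel_arrows k \<sigma> p q UNIV UNIV"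
  shows "emeasure rng_measure B = emeasure (density src_measure (\<lambda>\<gamma>. ennreal (exp (c \<gamma>)))) B"
proof -
  let ?E = "\<lambda>p x. ennreal (exp (weight p x))"
  let ?h = "\<lambda>\<gamma>. ennreal (exp (c \<gamma>)) * indicator B \<gamma>"
  \<comment> \<open>Invariance under an iterate replaces fibre sums along \<open>r\<close> by fibre
    sums along the longer map, at the price of its weight. It serves forwards for range and
    \<open>p\<close>, backwards for source and \<open>q\<close>.\<close>
  have push: "(\<integral>\<^sup>+x. fsum r h x \<partial>\<mu>) = (\<integral>\<^sup>+x. fsum (\<lambda>\<gamma>. siter \<sigma> k p (r \<gamma>)) (\<lambda>\<gamma>. ?E p (r \<gamma>) * h \<gamma>) x \<partial>\<mu>)"
    if "fsum r h \<in> borel_measurable \<mu>" "p \<in> multi_idx k" for r :: "'a garrow \<Rightarrow> 'a" and h p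
  proof -
    have "(\<integral>\<^sup>+x. fsum r h x \<partial>\<mu>) = (\<integral>\<^sup>+x. fsum (siter \<sigma> k p) (\<lambda>y. ?E p y * fsum r h y) x \<partial>\<mu>)"
      using weight_invariant[OF inv that(2)] measurable_mu[OF that(1)]
      unfolding transfer_invariant_def by simp
    also have "(\<lambda>y. ?E p y * fsum r h y) = fsum r (\<lambda>\<gamma>. ?E p (r \<gamma>) * h \<gamma>)"
      by (rule ext) (rule fsum_cmult_fibre[symmetric])
    finally show ?thesis
      by (simp only: fsum_comp)
  qed
  have indB: "indicator B \<gamma> * indicator (space G) \<gamma> = (indicator B \<gamma> :: ennreal)" for \<gamma>
    using sets.sets_into_space[OF B(1)] by (auto simp: indicator_def)
  have h: "?h \<in> borel_measurable G" using B by measurable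
  have supp: "siter \<sigma> k p (g_rng \<gamma>) = siter \<sigma> k q (g_src \<gamma>) \<and>
      ?E p (g_rng \<gamma>) = ?E q (g_src \<gamma>) * ennreal (exp (c \<gamma>))" if "\<gamma> \<in> B" for \<gamma>
  proof -
    obtain x y where \<gamma>: "\<gamma> = (x, idx_diff p q, y)" "siter \<sigma> k p x = siter \<sigma> k q y"
      using \<open>\<gamma> \<in> B\<close> B(2) unfolding rel_arrows_def by blast
    then show ?thesis
      using c_eq_weight_diff[OF p q \<gamma>(2)]
      by (simp add: g_rng_def g_src_def exp_add ennreal_mult[symmetric] mult.commute)
  qed
  have "emeasure rng_measure B =
      (\<integral>\<^sup>+x. fsum (\<lambda>\<gamma>. siter \<sigma> k p (g_rng \<gamma>)) (\<lambda>\<gamma>. ?E p (g_rng \<gamma>) * indicator B \<gamma>) x \<partial>\<mu>)"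
    by (simp add: emeasure_pullback_measure[OF cs_rng B(1)] push fsum_indicator_measurable[OF cs_rng B(1)] p)
  also have "(\<lambda>\<gamma>. ?E p (g_rng \<gamma>) * indicator B \<gamma>) = (\<lambda>\<gamma>. ?E q (g_src \<gamma>) * ?h \<gamma>)"
    using supp by (auto simp: fun_eq_iff indicator_def)
  also have "fsum (\<lambda>\<gamma>. siter \<sigma> k p (g_rng \<gamma>)) (\<lambda>\<gamma>. ?E q (g_src \<gamma>) * ?h \<gamma>) =
      fsum (\<lambda>\<gamma>. siter \<sigma> k q (g_src \<gamma>)) (\<lambda>\<gamma>. ?E q (g_src \<gamma>) * ?h \<gamma>)"
    using supp by (intro fsum_cong_support) (auto simp: indicator_def split: if_splits)
  also have "(\<integral>\<^sup>+x. \<dots> x \<partial>\<mu>) = (\<integral>\<^sup>+x. fsum g_src ?h x \<partial>\<mu>)"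
    using fsum_measurable[OF cs_src h] by (intro push[symmetric] q) (simp only: indB mult.assoc)
  also have "\<dots> = (\<integral>\<^sup>+\<gamma>. ?h \<gamma> \<partial>src_measure)"
    by (simp only: nn_integral_pullback_measure[OF cs_src h] indB mult.assoc)
  also have "\<dots> = emeasure (density src_measure (\<lambda>\<gamma>. ennreal (exp (c \<gamma>)))) B"
    using B(1) by (intro emeasure_density[symmetric]) (simp_all cong: measurable_cong_sets)
  finally show ?thesis .
qed

text \<open>Countably many pairs \<open>p\<close>, \<open>q\<close> exhaust the groupoid. The pieces
  overlap, so they are made disjoint before countable additivity reassembles
  \<open>B\<close>.\<close>

lemma rng_eq_density:
  assumes inv: "\<And>i. i < k \<Longrightarrow> transfer_invariant \<mu> (\<sigma> i) (\<lambda>y. ennreal (exp (\<phi> i y)))"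
  shows "rng_measure = density src_measure (\<lambda>\<gamma>. ennreal (exp (c \<gamma>)))" (is "?R = ?S")
proof (rule measure_eqI)
  show "sets ?R = sets ?S" by simp
  fix B assume "B \<in> sets ?R"
  then have B: "B \<in> sets G" by simp
  define I where "I = from_nat_into (multi_idx k \<times> multi_idx k)"
  have ne: "multi_idx k \<times> multi_idx k \<noteq> {}" using zero_in_multi_idx by blast
  have I: "range I = multi_idx k \<times> multi_idx k"
    unfolding I_def using ne countable_multi_idx by (intro range_from_nat_into) auto
  define Z where "Z n = rel_arrows k \<sigma> (fst (I n)) (snd (I n)) UNIV UNIV" for n
  have I_mem: "fst (I n) \<in> multi_idx k" "snd (I n) \<in> multi_idx k" for n
    using I by (metis mem_Times_iff rangeI)+
  have Z: "Z n \<in> sets G" for n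
    unfolding Z_def by (intro openin_in_sets_G openin_rel_arrows I_mem) auto
  have prod: "(\<Union>x\<in>P \<times> Q. F (fst x) (snd x)) = (\<Union>p\<in>P. \<Union>q\<in>Q. F p q)"
    for F :: "(nat \<Rightarrow> nat) \<Rightarrow> (nat \<Rightarrow> nat) \<Rightarrow> 'a garrow set" and P Q
    by force
  have "(\<Union>n. Z n) = (\<Union>x\<in>range I. rel_arrows k \<sigma> (fst x) (snd x) UNIV UNIV)"
    unfolding Z_def image_image ..
  also have "\<dots> = space G"
    unfolding I space_G groupoid_eq_rel_arrows by (rule prod)
  finally have UZ: "(\<Union>n. Z n) = space G" .
  define D where "D n = B \<inter> disjointed Z n" for n
  have D: "range D \<subseteq> sets G"
    using sets.range_disjointed_sets[of Z G] Z B unfolding D_def by blast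
  have disj: "disjoint_family D"
    using disjoint_family_disjointed[of Z] unfolding D_def disjoint_family_on_def by blast
  have "(\<Union>n. D n) = B \<inter> (\<Union>n. disjointed Z n)"
    unfolding D_def by (rule Int_UN_distrib[symmetric])
  also have "\<dots> = B"
    using sets.sets_into_space[OF B] by (simp only: UN_disjointed_eq UZ Int_absorb2)
  finally have UD: "(\<Union>n. D n) = B" .
  have "emeasure ?R (D n) = emeasure ?S (D n)" for n
  proof (rule emeasure_rng_eq_density[OF inv I_mem(1) I_mem(2)])
    show "D n \<in> sets G" using D by blast
    show "D n \<subseteq> rel_arrows k \<sigma> (fst (I n)) (snd (I n)) UNIV UNIV"
      using disjointed_subset[of Z n] unfolding D_def Z_def by blast
  qed
  moreover have "(\<Sum>n. emeasure ?R (D n)) = emeasure ?R B" "(\<Sum>n. emeasure ?S (D n)) = emeasure ?S B"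
    using D disj by (simp_all only: suminf_emeasure sets_pullback_measure sets_density UD)
  ultimately show "emeasure ?R B = emeasure ?S B" by simp
qed

lemma density_imp_transfer_invariant:
  assumes dens: "rng_measure = density src_measure (\<lambda>\<gamma>. ennreal (exp (c \<gamma>)))"
    and i: "i < k"
  shows "transfer_invariant \<mu> (\<sigma> i) (\<lambda>y. ennreal (exp (\<phi> i y)))"
  unfolding transfer_invariant_def
proof
  fix f :: "'a \<Rightarrow> ennreal" assume f [measurable]: "f \<in> borel_measurable borel"
  let ?e = "\<lambda>j. if j = i then 1 else (0::nat)"
  let ?E = "\<lambda>x. ennreal (exp (\<phi> i x))"
  \<comment> \<open>\<open>Z\<close> is a copy of the graph of \<sigma> \<open>i\<close>: range maps
    it bijectively onto X, and source is \<sigma> \<open>i\<close> after range.\<close>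
  define Z where "Z = rel_arrows k \<sigma> ?e (\<lambda>_. 0) UNIV UNIV"
  have Z [measurable]: "Z \<in> sets G"
    unfolding Z_def using i by (intro openin_in_sets_G openin_rel_arrows) auto
  have indZ: "indicator Z \<gamma> * indicator (space G) \<gamma> = (indicator Z \<gamma> :: ennreal)" for \<gamma>
    using sets.sets_into_space[OF Z] by (auto simp: indicator_def)
  have Z_mem: "\<sigma> i (g_rng \<gamma>) = g_src \<gamma> \<and> c \<gamma> = \<phi> i (g_rng \<gamma>)" if "\<gamma> \<in> Z" for \<gamma>
    using that cocycle i unfolding Z_def rel_arrows_def siter_unit[OF i] idx_diff_unit is_cocycle_c_def
    by (auto simp: g_rng_def g_src_def)
  have "inj_on g_rng Z" unfolding Z_def by (rule inj_on_g_rng) simp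
  moreover have "g_rng ` Z = UNIV"
    unfolding Z_def g_rng_rel_arrows by simp
  ultimately have one: "fsum g_rng (indicator Z) x = 1" for x
    by (simp add: fsum_indicator_inj)
  \<comment> \<open>Lifting a function to \<open>Z\<close> and summing over range fibres gives it
    back, as \<open>Z\<close> meets each such fibre exactly once.\<close>
  have restrict: "fsum g_rng (\<lambda>\<gamma>. w (g_rng \<gamma>) * indicator Z \<gamma>) = w" for w
    by (rule ext) (simp add: fsum_cmult_fibre one)
  let ?h = "\<lambda>\<gamma>. f (g_rng \<gamma>) * indicator Z \<gamma>"
  have h: "?h \<in> borel_measurable G" by measurable
  have ch: "(\<lambda>\<gamma>. ennreal (exp (c \<gamma>)) * ?h \<gamma>) \<in> borel_measurable G" by measurable
  have "(\<integral>\<^sup>+x. f x \<partial>\<mu>) = (\<integral>\<^sup>+\<gamma>. ?h \<gamma> \<partial>rng_measure)"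
    by (simp only: nn_integral_pullback_measure[OF cs_rng h] mult.assoc indZ restrict)
  also have "\<dots> = (\<integral>\<^sup>+\<gamma>. ennreal (exp (c \<gamma>)) * ?h \<gamma> \<partial>src_measure)"
    unfolding dens using h by (intro nn_integral_density) (simp_all cong: measurable_cong_sets)
  also have "\<dots> = (\<integral>\<^sup>+x. fsum g_src (\<lambda>\<gamma>. ennreal (exp (c \<gamma>)) * ?h \<gamma>) x \<partial>\<mu>)"
    by (simp only: nn_integral_pullback_measure[OF cs_src ch] mult.assoc indZ)
  also have "(\<lambda>\<gamma>. ennreal (exp (c \<gamma>)) * ?h \<gamma>) = (\<lambda>\<gamma>. ?E (g_rng \<gamma>) * f (g_rng \<gamma>) * indicator Z \<gamma>)"
    using Z_mem by (auto simp: fun_eq_iff indicator_def)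
  \<comment> \<open>On \<open>Z\<close> the source factors through the range, so functoriality
    reduces the fibre sum to one along \<sigma> \<open>i\<close> on X.\<close>
  also have "fsum g_src \<dots> = fsum (\<lambda>\<gamma>. \<sigma> i (g_rng \<gamma>)) \<dots>"
    using Z_mem by (intro fsum_cong_support) (auto simp: indicator_def split: if_splits)
  also have "\<dots> = fsum (\<sigma> i) (\<lambda>x. ?E x * f x)"
    by (rule ext) (simp only: fsum_comp restrict[of "\<lambda>x. ?E x * f x"])
  finally show "(\<integral>\<^sup>+x. fsum (\<sigma> i) (\<lambda>y. ?E y * f y) x \<partial>\<mu>) = (\<integral>\<^sup>+x. f x \<partial>\<mu>)"
    by simp
qed

text \<open>From left to right the existence part of Radon-Nikodym applies, from right to left its
  uniqueness. The exponential never vanishes, so the density has no null sets beyond those of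
  \<open>src_measure\<close>, and absolute continuity holds in both directions.\<close>

lemma quasi_invariant_iff_density:
  "absolutely_continuous rng_measure src_measure \<and> absolutely_continuous src_measure rng_measure \<and>
     (AE \<gamma> in src_measure. RN_deriv src_measure rng_measure \<gamma> = ennreal (exp (c \<gamma>)))
   \<longleftrightarrow> rng_measure = density src_measure (\<lambda>\<gamma>. ennreal (exp (c \<gamma>)))"
  (is "?L \<longleftrightarrow> rng_measure = ?D")
proof -
  have "finite_measure \<mu>"
    using mu by (simp add: borel_prob_def prob_space_def)
  then interpret sigma_finite_measure src_measure
    by (rule sigma_finite_pullback_measure[OF cs_src])
  have ec: "(\<lambda>\<gamma>. ennreal (exp (c \<gamma>))) \<in> borel_measurable src_measure"
    by (simp cong: measurable_cong_sets)
  show ?thesis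
  proof
    assume L: ?L
    then have "rng_measure = density src_measure (RN_deriv src_measure rng_measure)"
      by (simp add: density_RN_deriv)
    also have "\<dots> = ?D"
      using L ec by (intro density_cong) auto
    finally show "rng_measure = ?D" .
  next
    assume R: "rng_measure = ?D"
    have "absolutely_continuous src_measure ?D"
      using ec by (rule absolutely_continuousI_density)
    moreover have "absolutely_continuous ?D src_measure"
      unfolding absolutely_continuous_def
    proof
      fix A assume "A \<in> null_sets ?D"
      then have "A \<in> sets src_measure" "AE \<gamma> in src_measure. \<gamma> \<in> A \<longrightarrow> ennreal (exp (c \<gamma>)) = 0"
        unfolding null_sets_density_iff[OF ec] by blast+
      then have "AE \<gamma> in src_measure. \<gamma> \<notin> A" by simp
      then show "A \<in> null_sets src_measure"
        using \<open>A \<in> sets src_measure\<close> by (subst AE_iff_null_sets) auto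
    qed
    moreover have "AE \<gamma> in src_measure. ennreal (exp (c \<gamma>)) = RN_deriv src_measure rng_measure \<gamma>"
      using ec R[symmetric] by (rule RN_deriv_unique)
    ultimately show ?L
      by (simp add: R[symmetric] eq_commute)
  qed
qed

end

theorem theorem5p3:
  fixes k :: nat and \<sigma> :: "nat \<Rightarrow> 'a::metric_space \<Rightarrow> 'a" and \<phi> :: "nat \<Rightarrow> 'a \<Rightarrow> real"
    and c :: "'a garrow \<Rightarrow> real" and \<mu> :: "'a measure"
  assumes "ruelle_system k \<sigma> \<phi>"
    and "unique_dual_eigen k \<sigma> \<phi>"
    and "is_cocycle_c k \<sigma> \<phi> c"
    and "borel_prob \<mu>"
  shows "(absolutely_continuous (rng_pull k \<sigma> \<mu>) (src_pull k \<sigma> \<mu>) \<and>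
          absolutely_continuous (src_pull k \<sigma> \<mu>) (rng_pull k \<sigma> \<mu>) \<and>
          (AE \<gamma> in src_pull k \<sigma> \<mu>.
             RN_deriv (src_pull k \<sigma> \<mu>) (rng_pull k \<sigma> \<mu>) \<gamma> = ennreal (exp (c \<gamma>))))
     \<longleftrightarrow> (\<forall>i<k. dual_eigen (\<sigma> i) (\<phi> i) \<mu> 1)"
proof -
  interpret cocycle_action k \<sigma> \<phi> c \<mu>
    using assms by unfold_locales (auto simp: ruelle_system_def intro: local_homeo_imp_etale)
  \<comment> \<open>Each generator is treated separately; the groupoid then links the whole family
    of invariances to a single density identity.\<close>
  have "dual_eigen (\<sigma> i) (\<phi> i) \<mu> 1 \<longleftrightarrow> transfer_invariant \<mu> (\<sigma> i) (\<lambda>y. ennreal (exp (\<phi> i y)))"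
    if "i < k" for i
    using dual_eigen_imp_transfer_invariant[OF compact etale[OF that] phi[OF that] mu]
      transfer_invariant_imp_dual_eigen[OF compact etale[OF that] phi[OF that] mu] by blast
  then have "(\<forall>i<k. dual_eigen (\<sigma> i) (\<phi> i) \<mu> 1) \<longleftrightarrow>
      rng_measure = density src_measure (\<lambda>\<gamma>. ennreal (exp (c \<gamma>)))"
    using rng_eq_density density_imp_transfer_invariant by blast
  then show ?thesis
    unfolding rng_pull_eq src_pull_eq quasi_invariant_iff_density by (rule sym)
qed

end
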